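(* Let $M,s\in\mathbb N$ with $M\ge 2$, let $\alpha>1/2$ be real, $\boldsymbol\gamma=(\gamma_1,\gamma_2,\ldots)\in[0,1]^{\mathbb N}$ and $\tau\in(0,1)$. Assume $$M\ \ge\ \inf_{1/2\le\lambda'<\alpha}\ \frac{2}{1-\tau}\sum_{\emptyset\ne u\subseteq\{1,\ldots,s\}}\gamma_u^{1/\lambda'}\bigl(2\zeta(\alpha/\lambda')\bigr)^{|u|}.$$ Then for any $1/2<\lambda<\alpha$ and $0<\delta<\min(\lambda-1/2,1)$, the randomized error of the randomized tent-transformed rank-1 lattice rule $A^{\varphi}_{M,\tau}$ in the weighted half-period cosine space satisfies $$e^{\mathrm{rand}}(H^{\cos}_{s,\alpha,\boldsymbol\gamma},A^{\varphi}_{M,\tau})\ \le\ \frac{C_{\lambda,\delta,\tau}}{M^{\lambda+1/2-\delta}}\left(\sum_{\emptyset\ne u\subseteq\{1,\ldots,s\}}\gamma_u^{1/\lambda}\bigl(2\zeta(\alpha/\lambda)\bigr)^{|u|}\right)^{\lambda-\delta},$$ where $C_{\lambda,\delta,\tau}>0$ is a constant depending only on $\lambda,\delta,\tau$.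
   Context: Notation: $\mathbb N=\{1,2,\ldots\}$, $\mathbb N_0=\mathbb N\cup\{0\}$; $\zeta$ is the Riemann zeta function; $\gamma_u=\prod_{j\in u}\gamma_j$. $I(f)=\int_{[0,1]^s}f(\boldsymbol x)\,d\boldsymbol x$, and for a finite point (multi)set $P$ with $N$ elements, $I(f;P)=\frac1N\sum_{\boldsymbol x\in P}f(\boldsymbol x)$. For $\boldsymbol k\in\mathbb Z^{\ell}$ put $r_{\alpha,\boldsymbol\gamma}(\boldsymbol k)=\prod_{j:\,k_j\ne0}|k_j|^\alpha/\gamma_j$ (empty product $=1$; if $k_j\neq 0$ and $\gamma_j=0$ for some $j$, then $1/r_{\alpha,\boldsymbol\gamma}(\boldsymbol k)=0$). Weighted half-period cosine space. $H^{\cos}_{s,\alpha,\boldsymbol\gamma}$ is the space of functions $f:[0,1]^s\to\mathbb R$ with absolutely convergent cosine series $f(\boldsymbol x)=\sum_{\boldsymbol k\in\mathbb N_0^s}\bar f(\boldsymbol k)\prod_{j=1}^s(2-\delta_{0,k_j})^{1/2}\cos(\pi k_jx_j)$, where $\delta_{0,k}$ is the Kronecker delta and $\bar f(\boldsymbol k)=\int_{[0,1]^s}f(\boldsymbol x)\prod_{j=1}^s(2-\delta_{0,k_j})^{1/2}\cos(\pi k_jx_j)\,d\boldsymbol x$, and with finite norm $\|f\|^{\cos}_{s,\alpha,\boldsymbol\gamma}=\bigl(\sum_{\boldsymbol k\in\mathbb N_0^s}r_{\alpha,\boldsymbol\gamma}(\boldsymbol k)^2\bar f(\boldsymbol k)^2\bigr)^{1/2}$;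 if $\gamma_j=0$, it is required that $\bar f(\boldsymbol k)=0$ whenever $k_j\ne0$ (such terms contribute $0$ to the norm). Lattice rules. For $N\ge2$ and $\boldsymbol z\in\{1,\ldots,N-1\}^{\ell}$, $P_{N,\boldsymbol z}=\{\{n\boldsymbol z/N\}:n=0,\ldots,N-1\}$ (componentwise fractional parts), and $P_{N,\boldsymbol z}^\perp=\{\boldsymbol k\in\mathbb Z^{\ell}:\boldsymbol k\cdot\boldsymbol z\equiv0\pmod N\}$. The tent transformation is $\varphi(x)=1-|2x-1|$ on $[0,1]$, applied componentwise to vectors; $P^{\varphi}_{N,\boldsymbol z}=\varphi(P_{N,\boldsymbol z})$ is the tent-transformed point set (as a multiset indexed by $n$). Let $R_{\alpha,\boldsymbol\gamma}(\boldsymbol z)=\sum_{\boldsymbol k\in P_{N,\boldsymbol z}^\perp\setminus\{\boldsymbol 0\}}r_{\alpha,\boldsymbol\gamma}(\boldsymbol k)^{-2}$. Randomized component-by-component algorithm. Let $\mathbb P_M=\{N \text{ prime}:\lceil M/2\rceil<N\le M\}$. (1) Pick $N\in\mathbb P_M$ uniformly at random. (2) Set $z_1=1$. (3) For $\ell=2,\ldots,s$, given $\boldsymbol z_{\ell-1}=(z_1,\ldots,z_{\ell-1})$, let $Z_\ell\subset\{1,\ldots,N-1\}$ consist of the $\lceil\tau(N-1)\rceil$ elements $\zeta$ with the smallest values of $R_{\alpha,\boldsymbol\gamma}(\boldsymbol z_{\ell-1},\zeta)$ (ties broken in favour of the smaller integer), and pick $z_\ell\in Z_\ell$ uniformly at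 random. For $N\in\mathbb P_M$, $\mathcal Z_{N,\tau}\subseteq\{1,\ldots,N-1\}^s$ denotes the set of all vectors $\boldsymbol z=(z_1,\ldots,z_s)$ that steps (2)–(3) can produce. The randomized algorithm is $A^{\varphi}_{M,\tau}(f)=I(f;P^{\varphi}_{N,\boldsymbol z})=I(f\circ\varphi;P_{N,\boldsymbol z})$ with $N$ uniform in $\mathbb P_M$ and $\boldsymbol z$ uniform in $\mathcal Z_{N,\tau}$, and $$e^{\mathrm{rand}}(H^{\cos}_{s,\alpha,\boldsymbol\gamma},A^{\varphi}_{M,\tau})=\sup_{\|f\|^{\cos}_{s,\alpha,\boldsymbol\gamma}\le1}\frac1{|\mathbb P_M|}\sum_{N\in\mathbb P_M}\frac1{|\mathcal Z_{N,\tau}|}\sum_{\boldsymbol z\in\mathcal Z_{N,\tau}}|I(f;P^{\varphi}_{N,\boldsymbol z})-I(f)|.$$ *)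

theory Defs
  imports
    "HOL-Analysis.Analysis"
    "HOL-Library.Multiset"
    "HOL-Number_Theory.Cong"
    "HOL-Computational_Algebra.Primes"
begin

text \<open>
  An \<open>l\<close>-dimensional vector is an extensional function on \<open>{1..l}\<close> (equal to
  \<open>undefined\<close> elsewhere), so that dimensions can be quantified over and prefixes of
  vectors can be formed. The weights are functions \<open>\<gamma> :: nat \<Rightarrow> real\<close>; the value
  \<open>\<gamma> 0\<close> is never used.
\<close>

definition cube :: "nat \<Rightarrow> (nat \<Rightarrow> real) set" where
  "cube s = ({1..s} \<rightarrow>\<^sub>E {0..1})"

definition cube_integral :: "nat \<Rightarrow> ((nat \<Rightarrow> real) \<Rightarrow> real) \<Rightarrow> real" where
  "cube_integral s f = set_lebesgue_integral (PiM {1..s} (\<lambda>_. lborel)) (cube s) f"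

definition multiset_average :: "((nat \<Rightarrow> real) \<Rightarrow> real) \<Rightarrow> (nat \<Rightarrow> real) multiset \<Rightarrow> real" where
  "multiset_average f P = (\<Sum>x\<in>#P. f x) / real (size P)"

definition nat_vecs :: "nat \<Rightarrow> (nat \<Rightarrow> nat) set" where
  "nat_vecs s = ({1..s} \<rightarrow>\<^sub>E UNIV)"

definition int_vecs :: "nat \<Rightarrow> (nat \<Rightarrow> int) set" where
  "int_vecs l = ({1..l} \<rightarrow>\<^sub>E UNIV)"

text \<open>
  If \<open>k j \<noteq> 0\<close> and \<open>\<gamma> j = 0\<close> for some \<open>j\<close>, then division by zero makes
  \<open>korobov_weight\<close>, and hence its inverse, equal to \<open>0\<close>. This gives exactly the conventions
  wanted: \<open>1 / r\<close> is \<open>0\<close> in \<open>lattice_merit\<close>, and the corresponding terms contribute \<open>0\<close> to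
  \<open>cosine_norm\<close>.
\<close>

definition korobov_weight :: "real \<Rightarrow> (nat \<Rightarrow> real) \<Rightarrow> nat \<Rightarrow> (nat \<Rightarrow> int) \<Rightarrow> real" where
  "korobov_weight \<alpha> \<gamma> l k = (\<Prod>j\<in>{j\<in>{1..l}. k j \<noteq> 0}. (real_of_int \<bar>k j\<bar>) powr \<alpha> / \<gamma> j)"

definition cosine_basis :: "nat \<Rightarrow> (nat \<Rightarrow> nat) \<Rightarrow> (nat \<Rightarrow> real) \<Rightarrow> real" where
  "cosine_basis s k x = (\<Prod>j=1..s. sqrt (2 - of_bool (k j = 0)) * cos (pi * real (k j) * x j))"

definition cosine_coeff :: "nat \<Rightarrow> ((nat \<Rightarrow> real) \<Rightarrow> real) \<Rightarrow> (nat \<Rightarrow> nat) \<Rightarrow> real" where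
  "cosine_coeff s f k = cube_integral s (\<lambda>x. f x * cosine_basis s k x)"

definition cosine_norm_terms ::
    "real \<Rightarrow> (nat \<Rightarrow> real) \<Rightarrow> nat \<Rightarrow> ((nat \<Rightarrow> real) \<Rightarrow> real) \<Rightarrow> (nat \<Rightarrow> nat) \<Rightarrow> real" where
  "cosine_norm_terms \<alpha> \<gamma> s f k =
     (korobov_weight \<alpha> \<gamma> s (\<lambda>j. int (k j)))\<^sup>2 * (cosine_coeff s f k)\<^sup>2"

definition cosine_norm :: "real \<Rightarrow> (nat \<Rightarrow> real) \<Rightarrow> nat \<Rightarrow> ((nat \<Rightarrow> real) \<Rightarrow> real) \<Rightarrow> real" where
  "cosine_norm \<alpha> \<gamma> s f = sqrt (\<Sum>\<^sub>\<infinity>k\<in>nat_vecs s. cosine_norm_terms \<alpha> \<gamma> s f k)"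

text \<open>
  Functions on \<open>[0,1]\<^sup>s\<close> are represented by total functions whose values outside
  \<open>cube s\<close> play no role. Summability of the norm terms expresses finiteness of the norm.
\<close>

definition cosine_space ::
    "real \<Rightarrow> (nat \<Rightarrow> real) \<Rightarrow> nat \<Rightarrow> ((nat \<Rightarrow> real) \<Rightarrow> real) set" where
  "cosine_space \<alpha> \<gamma> s = {f.
     (\<forall>x\<in>cube s.
        (\<lambda>k. \<bar>cosine_coeff s f k * cosine_basis s k x\<bar>) summable_on nat_vecs s \<and>
        ((\<lambda>k. cosine_coeff s f k * cosine_basis s k x) has_sum f x) (nat_vecs s)) \<and>
     cosine_norm_terms \<alpha> \<gamma> s f summable_on nat_vecs s \<and>
     (\<forall>k\<in>nat_vecs s. \<forall>j\<in>{1..s}. \<gamma> j = 0 \<and> k j \<noteq> 0 \<longrightarrow> cosine_coeff s f k = 0)}"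

definition lattice_points :: "nat \<Rightarrow> nat \<Rightarrow> (nat \<Rightarrow> nat) \<Rightarrow> (nat \<Rightarrow> real) multiset" where
  "lattice_points s N z =
     image_mset (\<lambda>n. \<lambda>j\<in>{1..s}. frac (real n * real (z j) / real N)) (mset_set {..<N})"

definition tent :: "real \<Rightarrow> real" where
  "tent x = 1 - \<bar>2 * x - 1\<bar>"

definition tent_lattice_points :: "nat \<Rightarrow> nat \<Rightarrow> (nat \<Rightarrow> nat) \<Rightarrow> (nat \<Rightarrow> real) multiset" where
  "tent_lattice_points s N z = image_mset (\<lambda>x. \<lambda>j\<in>{1..s}. tent (x j)) (lattice_points s N z)"

definition dual_lattice :: "nat \<Rightarrow> nat \<Rightarrow> (nat \<Rightarrow> nat) \<Rightarrow> (nat \<Rightarrow> int) set" where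
  "dual_lattice l N z = {k \<in> int_vecs l. [(\<Sum>j=1..l. k j * int (z j)) = 0] (mod int N)}"

definition lattice_merit ::
    "real \<Rightarrow> (nat \<Rightarrow> real) \<Rightarrow> nat \<Rightarrow> nat \<Rightarrow> (nat \<Rightarrow> nat) \<Rightarrow> real" where
  "lattice_merit \<alpha> \<gamma> N l z =
     (\<Sum>\<^sub>\<infinity>k\<in>dual_lattice l N z - {\<lambda>j\<in>{1..l}. 0}. 1 / (korobov_weight \<alpha> \<gamma> l k)\<^sup>2)"

text \<open>
  The set from which the component number \<open>l\<close> is drawn, given the components \<open>z\<close> with
  indices in \<open>{1..l - 1}\<close>. As \<open>sort_key\<close> is stable, ties are broken in favour of the smaller
  integer.
\<close>

definition cbc_candidates ::
    "real \<Rightarrow> (nat \<Rightarrow> real) \<Rightarrow> real \<Rightarrow> nat \<Rightarrow> nat \<Rightarrow> (nat \<Rightarrow> nat) \<Rightarrow> nat set" where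
  "cbc_candidates \<alpha> \<gamma> \<tau> N l z =
     set (take (nat \<lceil>\<tau> * (real N - 1)\<rceil>)
       (sort_key (\<lambda>c. lattice_merit \<alpha> \<gamma> N l (z(l := c))) [1..<N]))"

definition cbc_vectors ::
    "real \<Rightarrow> (nat \<Rightarrow> real) \<Rightarrow> real \<Rightarrow> nat \<Rightarrow> nat \<Rightarrow> (nat \<Rightarrow> nat) set" where
  "cbc_vectors \<alpha> \<gamma> \<tau> s N = {z \<in> {1..s} \<rightarrow>\<^sub>E {1..N - 1}.
     z 1 = 1 \<and> (\<forall>l\<in>{2..s}. z l \<in> cbc_candidates \<alpha> \<gamma> \<tau> N l (restrict z {1..l - 1}))}"

definition admissible_primes :: "nat \<Rightarrow> nat set" where
  "admissible_primes M = {N. prime N \<and> \<lceil>real M / 2\<rceil> < int N \<and> N \<le> M}"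

text \<open>
  The supremum is taken in the extended reals, so that it is meaningful without a prior
  boundedness argument.
\<close>

definition randomized_error ::
    "real \<Rightarrow> (nat \<Rightarrow> real) \<Rightarrow> real \<Rightarrow> nat \<Rightarrow> nat \<Rightarrow> ereal" where
  "randomized_error \<alpha> \<gamma> \<tau> s M =
     (SUP f\<in>{f \<in> cosine_space \<alpha> \<gamma> s. cosine_norm \<alpha> \<gamma> s f \<le> 1}.
        ereal (1 / real (card (admissible_primes M)) * (\<Sum>N\<in>admissible_primes M.
          1 / real (card (cbc_vectors \<alpha> \<gamma> \<tau> s N)) * (\<Sum>z\<in>cbc_vectors \<alpha> \<gamma> \<tau> s N.
            \<bar>multiset_average f (tent_lattice_points s N z) - cube_integral s f\<bar>))))"

text \<open>The Riemann zeta function at real arguments \<open>x > 1\<close>, the only ones that occur.\<close>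

definition zeta_real :: "real \<Rightarrow> real" where
  "zeta_real x = (\<Sum>n. 1 / real (Suc n) powr x)"

definition weight_zeta_sum :: "real \<Rightarrow> (nat \<Rightarrow> real) \<Rightarrow> nat \<Rightarrow> real \<Rightarrow> real" where
  "weight_zeta_sum \<alpha> \<gamma> s \<nu> =
     (\<Sum>u\<in>Pow {1..s} - {{}}. (\<Prod>j\<in>u. \<gamma> j) powr (1 / \<nu>) * (2 * zeta_real (\<alpha> / \<nu>)) ^ card u)"

end

theory Submission
  imports Defs "HOL-Real_Asymp.Real_Asymp"
begin

text \<open>
  The tent transformation turns \<open>cos (\<pi> k x)\<close> into \<open>cos (2 \<pi> k x)\<close>, so by expanding products of
  cosines the lattice rule with generator \<open>z\<close> maps the basis function with index \<open>k\<close> to its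
  normalising factor times the fraction of sign changes \<open>h\<close> of \<open>k\<close> that lie in the dual lattice of
  \<open>z\<close>. By the Cauchy--Schwarz inequality the error is at most the square root of the sum of
  \<open>\<omega>(h)\<^sup>2 r(h)\<^bsup>-2\<^esup>\<close> over \<open>h \<noteq> 0\<close>, where \<open>\<omega>(h)\<close> is the probability that \<open>h\<close> lies in the random
  dual lattice.

  Two facts bound this sum. First, averaging over the candidates for \<open>z\<^sub>l\<close>, where \<open>h\<^sub>l\<close> is the
  last nonzero component of \<open>h\<close>, shows that \<open>r(h)\<^bsup>-1/\<lambda>\<^esup>\<close> is at most a constant times \<open>W / M\<close> for
  every \<open>h\<close> with \<open>\<omega>(h) > 0\<close>, where \<open>W\<close> is the sum over \<open>u\<close> in the theorem. Secondly, \<open>\<omega>(h)\<close> is of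
  order \<open>(1 + ln |h\<^sub>j|) / M\<close> for any \<open>h\<^sub>j \<noteq> 0\<close>: if \<open>N\<close> does not divide \<open>h\<close>, the congruence fixes one
  component of \<open>z\<close> given the previous ones, and only \<open>O(ln |h\<^sub>j| / ln M)\<close> of the primes divide \<open>h\<^sub>j\<close>,
  while there are at least of order \<open>M / ln M\<close> primes to choose from (Chebyshev's argument with
  central binomial coefficients). The logarithm is absorbed by a power \<open>r(h)\<^bsup>\<delta>/\<lambda>\<^esup>\<close>.
\<close>

subsection \<open>Primes between M/2 and M\<close>

text \<open>Legendre's formula by induction: from n to n + 1 the quotient by p^i grows by one
  exactly when p^i divides n + 1, and the number of such i is the multiplicity of p in n + 1. The
  hypothesis on K ensures that all these i are counted.\<close>

lemma multiplicity_fact: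
  fixes p n K :: nat
  assumes p: "prime p" and n: "n < p ^ Suc K"
  shows "multiplicity p (fact n :: nat) = (\<Sum>i=1..K. n div p ^ i)"
  using n
proof (induction n)
  case 0
  then show ?case by simp
next
  case (Suc n)
  have p2: "p > 1" using p prime_gt_1_nat by blast
  have "p ^ multiplicity p (Suc n) \<le> Suc n"
    by (intro dvd_imp_le multiplicity_dvd) auto
  also have "\<dots> < p ^ Suc K" by fact
  finally have "multiplicity p (Suc n) < Suc K"
    using p2 power_less_imp_less_exp by blast
  hence mK: "multiplicity p (Suc n) \<le> K" by simp
  have "p ^ i dvd Suc n \<longleftrightarrow> i \<le> multiplicity p (Suc n)" for i
    using p by (intro power_dvd_iff_le_multiplicity) auto
  hence "(\<Sum>i=1..K. of_bool (p ^ i dvd Suc n)) = card {i\<in>{1..K}. i \<le> multiplicity p (Suc n)}"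
    by (simp add: Int_def)
  also have "{i\<in>{1..K}. i \<le> multiplicity p (Suc n)} = {1..multiplicity p (Suc n)}"
    using mK by auto
  finally have s: "(\<Sum>i=1..K. of_bool (p ^ i dvd Suc n)) = multiplicity p (Suc n)" by simp
  have "multiplicity p (fact (Suc n) :: nat) = multiplicity p (Suc n) + multiplicity p (fact n :: nat)"
    unfolding fact_Suc of_nat_id using p by (subst prime_elem_multiplicity_mult_distrib) auto
  also have "\<dots> = (\<Sum>i=1..K. of_bool (p ^ i dvd Suc n) + n div p ^ i)"
    using Suc unfolding sum.distrib s by simp
  also have "\<dots> = (\<Sum>i=1..K. Suc n div p ^ i)"
    by (intro sum.cong) (auto simp: div_Suc mod_eq_0_iff_dvd)
  finally show ?case .
qed

lemma multiplicity_central_binomial: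
  fixes p n K :: nat
  assumes p: "prime p" and n: "2 * n < p ^ Suc K"
  shows "multiplicity p (2 * n choose n) = (\<Sum>i=1..K. 2 * n div p ^ i - 2 * (n div p ^ i))"
proof -
  have e: "fact (2 * n) = (2 * n choose n) * (fact n * fact n :: nat)"
    using binomial_fact_lemma[of n "2 * n"] by (simp add: mult_ac)
  have "multiplicity p (fact (2 * n) :: nat) = multiplicity p (2 * n choose n) + 2 * multiplicity p (fact n :: nat)"
    unfolding e using p by (simp add: prime_elem_multiplicity_mult_distrib)
  moreover have "multiplicity p (fact (2 * n) :: nat) = (\<Sum>i=1..K. 2 * n div p ^ i)"
    by (rule multiplicity_fact[OF p n])
  moreover have "multiplicity p (fact n :: nat) = (\<Sum>i=1..K. n div p ^ i)"
    using n by (intro multiplicity_fact[OF p]) auto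
  ultimately have "multiplicity p (2 * n choose n) = (\<Sum>i=1..K. 2 * n div p ^ i) - (\<Sum>i=1..K. 2 * (n div p ^ i))"
    by (simp add: sum_distrib_left)
  \<comment> \<open>Subtraction of naturals truncates, so splitting the difference into terms needs
    each subtrahend to be at most its minuend.\<close>
  also have "\<dots> = (\<Sum>i=1..K. 2 * n div p ^ i - 2 * (n div p ^ i))"
  proof (rule sum_subtractf_nat[symmetric])
    fix i
    have "2 * (n div p ^ i) * p ^ i \<le> 2 * n" by (simp add: mult.assoc)
    thus "2 * (n div p ^ i) \<le> 2 * n div p ^ i" using p
      by (subst less_eq_div_iff_mult_less_eq) (auto simp: prime_gt_0_nat)
  qed
  finally show ?thesis .
qed

lemma double_div_minus_le: "2 * n div q - 2 * (n div q) \<le> (1::nat)"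
proof (cases "q = 0")
  case False
  have "n < (n div q + 1) * q" using False by (simp add: dividend_less_div_times)
  hence "2 * n < (2 * (n div q) + 2) * q" by (simp add: algebra_simps)
  hence "2 * n div q < 2 * (n div q) + 2" using False by (simp add: less_mult_imp_div_less)
  thus ?thesis by simp
qed auto

text \<open>If p^m > 2n for the multiplicity m, then in Legendre's formula with terms i = 1..m the
  last term vanishes and every other is at most 1, so m would be at most m - 1.\<close>

lemma prime_power_central_binomial_le:
  fixes p n :: nat
  assumes p: "prime p" and "n > 0"
  shows "p ^ multiplicity p (2 * n choose n) \<le> 2 * n"
proof (rule ccontr)
  assume *: "\<not> ?thesis"
  define m where "m = multiplicity p (2 * n choose n)"
  have p2: "p \<ge> 2" using p prime_ge_2_nat by blast
  have m: "2 * n < p ^ m" using * m_def by simp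
  hence "m > 0" using assms by (cases m) auto
  have "multiplicity p (2 * n choose n) = (\<Sum>i=1..m. 2 * n div p ^ i - 2 * (n div p ^ i))"
    using m p2 by (intro multiplicity_central_binomial[OF p]) (auto intro: less_le_trans)
  also have "\<dots> \<le> (\<Sum>i=1..m. of_bool (i < m))"
    using m double_div_minus_le by (intro sum_mono) (auto simp: of_bool_def)
  also have "\<dots> = card {i\<in>{1..m}. i < m}"
    by (simp add: Int_def)
  also have "{i\<in>{1..m}. i < m} = {1..<m}" by auto
  finally show False using \<open>m > 0\<close> unfolding m_def by simp
qed

lemma prod_primes_dvd:
  fixes n :: nat
  assumes "finite A" "\<And>p. p \<in> A \<Longrightarrow> prime p" "\<And>p. p \<in> A \<Longrightarrow> p dvd n"
  shows "\<Prod>A dvd n"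
  using assms
proof (induction A rule: finite_induct)
  case (insert p A)
  have "coprime p (\<Prod>A)" using insert by (intro prod_coprime_right) (metis insert_iff primes_coprime)
  thus ?case using insert by (simp add: divides_mult)
qed auto

text \<open>Erdos's induction. An even n > 2 is not prime, so n - 1 gives the same product. For n =
  2m + 1 the primes in (m + 1, n] all divide the binomial coefficient of n over m, which is at most
  4^m because it occurs twice in a row with sum 2 * 4^m; the smaller primes are covered by the
  hypothesis for m + 1.\<close>

lemma primorial_le: "\<Prod>{p. prime p \<and> p \<le> n} \<le> (4::nat) ^ n"
proof (induction n rule: less_induct)
  case (less n)
  consider "n = 0" | "n = 1" | "n = 2" | m where "n = 2 * m" "m > 1" | m where "n = 2 * m + 1" "m > 0"
  proof -
    have "n = 0 \<or> n = 1 \<or> n = 2 \<or> (n = 2 * (n div 2) \<and> n div 2 > 1) \<or> (n = 2 * (n div 2) + 1 \<and> n div 2 > 0)"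
      by presburger
    thus ?thesis using that by metis
  qed
  then show ?case
  proof cases
    case 4
    have "\<not> prime (2 * m)" using 4 prime_product[of 2 m] by auto
    hence "{p. prime p \<and> p \<le> n} = {p. prime p \<and> p \<le> n - 1}" using 4
      by (auto simp: le_less)
    moreover have "\<Prod>{p. prime p \<and> p \<le> n - 1} \<le> 4 ^ (n - 1)" using 4 by (intro less) auto
    moreover have "(4::nat) ^ (n - 1) \<le> 4 ^ n" by (intro power_increasing) auto
    ultimately show ?thesis by (metis order_trans)
  next
    case 5
    let ?B = "{p. prime p \<and> m + 1 < p \<and> p \<le> n}"
    have e: "{p. prime p \<and> p \<le> n} = {p. prime p \<and> p \<le> m + 1} \<union> ?B" using 5 by auto
    have "\<Prod>{p. prime p \<and> p \<le> n} = \<Prod>{p. prime p \<and> p \<le> m + 1} * \<Prod>?B"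
      unfolding e by (intro prod.union_disjoint) auto
    also have "\<Prod>{p. prime p \<and> p \<le> m + 1} \<le> 4 ^ (m + 1)" using 5 by (intro less) auto
    also have "\<Prod>?B \<le> n choose m"
    proof (rule dvd_imp_le[OF prod_primes_dvd])
      fix p assume p: "p \<in> ?B"
      have "fact n = (n choose m) * (fact m * fact (m + 1) :: nat)"
        using binomial_fact_lemma[of m n] 5 by (simp add: mult_ac)
      moreover have "p dvd fact n" "\<not> p dvd fact m" "\<not> p dvd fact (m + 1)"
        using p prime_dvd_fact_iff[of p n] prime_dvd_fact_iff[of p m] prime_dvd_fact_iff[of p "m + 1"]
        by (simp_all del: fact_Suc)
      ultimately show "p dvd n choose m" using p by (metis (no_types, lifting) mem_Collect_eq prime_dvd_mult_iff)
    qed (use 5 in auto)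
    also have "n choose m \<le> 4 ^ m"
    proof -
      have "2 * (n choose m) = (\<Sum>k\<in>{m, m + 1}. n choose k)"
        using 5 binomial_symmetric[of m n] by simp
      also have "\<dots> \<le> (\<Sum>k\<le>n. n choose k)" using 5 by (intro sum_mono2) auto
      also have "\<dots> = 2 ^ n" by (rule choose_row_sum)
      also have "\<dots> = 2 * 4 ^ m" using 5 by (simp add: power_mult)
      finally show ?thesis by simp
    qed
    also have "4 ^ (m + 1) * 4 ^ m = (4::nat) ^ n" using 5 by (simp flip: power_add)
    finally show ?thesis by simp
  next
    case 3
    have "{p. prime p \<and> p \<le> n} = {2::nat}" using 3 prime_ge_2_nat by (auto simp: le_antisym)
    thus ?thesis using 3 by simp
  next
    case 1
    hence "{p. prime p \<and> p \<le> n} = {}" by auto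
    then show ?thesis by (metis One_nat_def one_le_numeral one_le_power prod.empty)
  next
    case 2
    hence "{p. prime p \<and> p \<le> n} = {}" by (auto dest: prime_ge_2_nat)
    then show ?thesis by (metis One_nat_def one_le_numeral one_le_power prod.empty)
  qed
qed


section \<open>Chebyshev's lower bound for the number of primes between n and 2n\<close>

text \<open>The prime factors are sorted by size. Each prime power is at most 2n, which bounds the
  contributions of p with p^2 \<le> 2n and of p > n. Primes with p^2 > 2n and 3p \<le> 2n occur at
  most once, so they are controlled by the primorial bound, and primes with 2n/3 < p \<le> n do not
  occur at all.\<close>

lemma central_binomial_le:
  fixes n :: nat
  assumes n: "n \<ge> 3"
  shows "2 * n choose n \<le> (2 * n) ^ card {p. prime p \<and> p\<^sup>2 \<le> 2 * n} * 4 ^ (2 * n div 3)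
           * (2 * n) ^ card {p. prime p \<and> n < p \<and> p \<le> 2 * n}"
proof -
  define B where "B = (2 * n choose n)"
  define S1 where "S1 = {p. prime p \<and> p\<^sup>2 \<le> 2 * n}"
  define S2 where "S2 = {p. prime p \<and> p\<^sup>2 > 2 * n \<and> 3 * p \<le> 2 * n}"
  define S3 where "S3 = {p. prime p \<and> n < p \<and> p \<le> 2 * n}"
  have f1: "finite S1"
  proof (rule finite_subset)
    have "p \<le> p\<^sup>2" for p :: nat by (cases "p = 0") (auto intro: self_le_power)
    thus "S1 \<subseteq> {..2 * n}" unfolding S1_def by (blast intro: order_trans)
  qed simp
  have f2: "finite S2"
    by (rule finite_subset[of _ "{..2 * n}"]) (auto simp: S2_def)
  have f3: "finite S3" unfolding S3_def by simp
  have B0: "B > 0" unfolding B_def by simp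
  have le: "p ^ multiplicity p B \<le> 2 * n" if "prime p" for p
    using prime_power_central_binomial_le[OF that, of n] n unfolding B_def by simp
  have one: "multiplicity p B \<le> 1" if "prime p" "2 * n < p\<^sup>2" for p
  proof -
    have "p ^ multiplicity p B < p ^ 2" using le[of p] that by simp
    from power_less_imp_less_exp[OF prime_gt_1_nat[OF that(1)] this] show ?thesis by simp
  qed
  have sub: "prime_factors B \<subseteq> S1 \<union> (S2 \<union> S3)"
  proof
    fix p assume "p \<in> prime_factors B"
    hence p: "prime p" "p dvd B" by auto
    hence pm: "multiplicity p B > 0" using B0 by (simp add: prime_multiplicity_gt_zero_iff)
    have p0: "p > 0" using p prime_gt_0_nat by blast
    have "p ^ 1 \<le> p ^ multiplicity p B" using p0 pm by (intro power_increasing) auto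
    hence p2n: "p \<le> 2 * n" using le[OF p(1)] by simp
    show "p \<in> S1 \<union> (S2 \<union> S3)"
    proof (rule ccontr)
      assume "p \<notin> S1 \<union> (S2 \<union> S3)"
      hence *: "2 * n < p\<^sup>2" "2 * n < 3 * p" "p \<le> n" using p p2n by (auto simp: S1_def S2_def S3_def)
      have "2 * n < p ^ Suc 1" using *(1) by (simp add: power2_eq_square)
      hence "multiplicity p B = (\<Sum>i=1..1. 2 * n div p ^ i - 2 * (n div p ^ i))"
        unfolding B_def by (intro multiplicity_central_binomial[OF p(1)])
      also have "\<dots> = 2 * n div p - 2 * (n div p)" by simp
      \<comment> \<open>For 2n/3 < p \<le> n the prime p divides n! once and (2n)! twice, so it
        cancels.\<close>
      also have "n div p = 1" using * p0 by (intro div_nat_eqI) auto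
      also have "2 * n div p = 2" using * p0 by (intro div_nat_eqI) auto
      finally show False using pm by simp
    qed
  qed
  let ?h = "\<lambda>p. p ^ multiplicity p B"
  have "B = (\<Prod>p\<in>prime_factors B. ?h p)"
    using prod_prime_factors[of B] B0 by simp
  also have "\<dots> = (\<Prod>p\<in>S1 \<union> (S2 \<union> S3). ?h p)"
    using sub f1 f2 f3 B0
    by (intro prod.mono_neutral_left)
       (auto simp: S1_def S2_def S3_def prime_factors_multiplicity)
  also have "\<dots> = (\<Prod>p\<in>S1. ?h p) * ((\<Prod>p\<in>S2. ?h p) * (\<Prod>p\<in>S3. ?h p))"
  proof -
    have "S2 \<inter> S3 = {}" by (auto simp: S2_def S3_def)
    moreover have "S1 \<inter> (S2 \<union> S3) = {}"
    proof -
      have "2 * n < p\<^sup>2" if "n < p" for p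
      proof -
        have "2 * n < 3 * p" using that by simp
        also have "\<dots> \<le> p * p" using that n by (intro mult_right_mono) auto
        finally show ?thesis by (simp add: power2_eq_square)
      qed
      hence "\<not> p\<^sup>2 \<le> 2 * n" if "p \<in> S2 \<union> S3" for p
        using that unfolding S2_def S3_def not_le by blast
      thus ?thesis unfolding S1_def by blast
    qed
    ultimately show ?thesis using f1 f2 f3 by (simp add: prod.union_disjoint)
  qed
  also have "\<dots> \<le> (2 * n) ^ card S1 * (4 ^ (2 * n div 3) * (2 * n) ^ card S3)"
  proof (intro mult_mono)
    show "(\<Prod>p\<in>S1. ?h p) \<le> (2 * n) ^ card S1"
      by (intro prod_le_power) (use le n in \<open>auto simp: S1_def\<close>)
    show "(\<Prod>p\<in>S3. ?h p) \<le> (2 * n) ^ card S3"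
      by (intro prod_le_power) (use le n in \<open>auto simp: S3_def\<close>)
    have "(\<Prod>p\<in>S2. ?h p) \<le> \<Prod>S2"
    proof (intro prod_mono conjI)
      fix p assume "p \<in> S2"
      hence "?h p \<le> p ^ 1" using one[of p] prime_ge_1_nat[of p] by (intro power_increasing) (auto simp: S2_def)
      thus "?h p \<le> p" by simp
    qed auto
    also have "\<Prod>S2 \<le> \<Prod>{p. prime p \<and> p \<le> 2 * n div 3}"
      by (intro dvd_imp_le prod_dvd_prod_subset prod_pos) (auto simp: S2_def dest: prime_gt_0_nat)
    also have "\<dots> \<le> 4 ^ (2 * n div 3)" by (rule primorial_le)
    finally show "(\<Prod>p\<in>S2. ?h p) \<le> 4 ^ (2 * n div 3)" .
  qed auto
  finally show ?thesis unfolding B_def S1_def S3_def by (simp add: mult_ac)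
qed

text \<open>Comparing 4^n / (2n) with the upper bound for the central binomial coefficient and
  taking logarithms gives n ln 4 / 3 \<le> (1 + sqrt(2n) + k) ln(2n), where k is the number of
  primes in question.\<close>

lemma card_primes_doubling_ge:
  "\<exists>n0. \<forall>n\<ge>n0. real n / (4 * ln (2 * real n)) \<le> real (card {p. prime p \<and> n < p \<and> p \<le> 2 * n})"
proof -
  have "eventually (\<lambda>n::nat. real n / (4 * ln (2 * real n)) \<le> real n * ln 4 / (3 * ln (2 * real n)) - 1 - sqrt (2 * real n)) at_top"
  proof -
    have "ln (4::real) \<ge> 1"
      using ln_le_cancel_iff[of "exp 1" "4::real"] exp_le by (simp del: ln_le_cancel_iff)
    \<comment> \<open>Since ln 4 / 3 is at least 1/3, settling for the factor 1/4 leaves a surplus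
      of n / (12 ln(2n)), which eventually exceeds 1 + sqrt(2n).\<close>
    hence "(1::real) / 12 \<le> ln 4 / 3 - 1 / 4" by simp
    hence c: "real n / (4 * ln (2 * real n)) + real n / ln (2 * real n) * (1/12) \<le> real n * ln 4 / (3 * ln (2 * real n))" if "n \<ge> 1" for n :: nat
    proof -
      have "real n / ln (2 * real n) * (1/12) \<le> real n / ln (2 * real n) * (ln 4 / 3 - 1 / 4)"
        using that \<open>1 / 12 \<le> ln 4 / 3 - 1 / 4\<close> by (intro mult_left_mono) auto
      moreover have "real n / (4 * ln (2 * real n)) = real n / ln (2 * real n) * (1 / 4)"
        "real n * ln 4 / (3 * ln (2 * real n)) = real n / ln (2 * real n) * (ln 4 / 3)" by simp_all
      ultimately show ?thesis unfolding right_diff_distrib by (metis le_diff_eq add.commute)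
    qed
    have "eventually (\<lambda>n::nat. 1 + sqrt (2 * real n) \<le> real n / ln (2 * real n) * (1/12)) at_top"
      by real_asymp
    thus ?thesis using eventually_ge_at_top[of 1]
    proof eventually_elim
      case (elim n)
      thus ?case using c[of n] by linarith
    qed
  qed
  then obtain n1 where n1: "\<And>n. n \<ge> n1 \<Longrightarrow> real n / (4 * ln (2 * real n)) \<le> real n * ln 4 / (3 * ln (2 * real n)) - 1 - sqrt (2 * real n)"
    by (auto simp: eventually_at_top_linorder)
  show ?thesis
  proof (intro exI[of _ "max 3 n1"] allI impI)
    fix n assume n: "n \<ge> max 3 n1"
    define k where "k = card {p. prime p \<and> n < p \<and> p \<le> 2 * n}"
    define m where "m = card {p::nat. prime p \<and> p\<^sup>2 \<le> 2 * n}"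
    define x where "x = 2 * real n"
    have x: "x > 1" "x = real (2 * n)" using n by (auto simp: x_def)
    have "m \<le> card {1..nat \<lfloor>sqrt x\<rfloor>}" unfolding m_def
    proof (intro card_mono)
      show "{p::nat. prime p \<and> p\<^sup>2 \<le> 2 * n} \<subseteq> {1..nat \<lfloor>sqrt x\<rfloor>}"
      proof safe
        fix p :: nat assume p: "prime p" "p\<^sup>2 \<le> 2 * n"
        have "real p ^ 2 \<le> x" using p(2) unfolding x(2) by (metis of_nat_le_iff of_nat_power)
        hence "real p \<le> sqrt x" by (rule real_le_rsqrt)
        thus "p \<in> {1..nat \<lfloor>sqrt x\<rfloor>}" using p(1) prime_ge_1_nat[of p] by (auto simp: le_nat_floor)
      qed
    qed auto
    hence m: "real m \<le> sqrt x" using x(1) by (simp add: le_nat_iff le_floor_iff)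
    have "4 ^ n / x \<le> real (2 * n choose n)"
      using central_binomial_lower_bound[of n] n by (simp add: x_def)
    also have "\<dots> \<le> real ((2 * n) ^ m * 4 ^ (2 * n div 3) * (2 * n) ^ k)"
      unfolding of_nat_le_iff m_def k_def using n by (intro central_binomial_le) auto
    also have "\<dots> = x ^ m * 4 ^ (2 * n div 3) * x ^ k" by (simp add: x_def)
    finally have "4 ^ n \<le> x * (x ^ m * 4 ^ (2 * n div 3) * x ^ k)" using x by (simp add: field_simps)
    hence "ln (4 ^ n) \<le> ln (x * (x ^ m * 4 ^ (2 * n div 3) * x ^ k))"
      using x(1) by (subst ln_le_cancel_iff) auto
    also have "\<dots> = ln x + real m * ln x + real (2 * n div 3) * ln 4 + real k * ln x"
      using x(1) by (simp add: ln_mult ln_realpow)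
    also have "ln (4 ^ n) = real n * ln (4::real)" by (simp add: ln_realpow)
    finally have 1: "real n * ln 4 \<le> ln x + real m * ln x + real (2 * n div 3) * ln 4 + real k * ln x" .
    have "real (2 * n div 3) \<le> 2 * real n / 3" by linarith
    hence "real (2 * n div 3) * ln 4 \<le> 2 * real n / 3 * ln 4" by (intro mult_right_mono) auto
    hence 2: "real (2 * n div 3) * ln 4 \<le> 2 / 3 * (real n * ln 4)" by simp
    have 3: "real m * ln x \<le> sqrt x * ln x" using m x(1) by (intro mult_right_mono) auto
    have "(1 + sqrt x + real k) * ln x = ln x + sqrt x * ln x + real k * ln x"
      by (simp add: distrib_right)
    hence "real n * ln 4 / 3 \<le> (1 + sqrt x + real k) * ln x"
      using 1 2 3 by linarith
    hence "real n * ln 4 \<le> (1 + sqrt x + real k) * (3 * ln x)" by simp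
    hence "real n * ln 4 / (3 * ln x) \<le> 1 + sqrt x + real k"
      using x(1) by (subst pos_divide_le_eq) auto
    moreover have "real n / (4 * ln x) \<le> real n * ln 4 / (3 * ln x) - 1 - sqrt x"
      using n1[of n] n by (simp only: x_def max.bounded_iff)
    ultimately show "real n / (4 * ln (2 * real n)) \<le> real k"
      unfolding x_def[symmetric] by linarith
  qed
qed

section \<open>The primes from which the algorithm draws\<close>

text \<open>Rounding M/2 up to n makes 2n equal to M or M + 1. The possible extra number 2n is
  composite because n \<ge> 2, so the interval has the doubling form that Chebyshev's bound
  needs.\<close>

lemma admissible_primes_eq:
  assumes "M \<ge> 3"
  shows "admissible_primes M = {p. prime p \<and> (M + 1) div 2 < p \<and> p \<le> 2 * ((M + 1) div 2)}"
proof -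
  have "\<lceil>real M / 2\<rceil> = int ((M + 1) div 2)"
    by (rule ceiling_unique) linarith+
  hence "admissible_primes M = {p. prime p \<and> (M + 1) div 2 < p \<and> p \<le> M}"
    unfolding admissible_primes_def by simp
  also have "\<dots> = {p. prime p \<and> (M + 1) div 2 < p \<and> p \<le> 2 * ((M + 1) div 2)}"
  proof -
    have "p \<noteq> 2 * ((M + 1) div 2)" if "prime p" for p
      using assms prime_product[of 2 "(M + 1) div 2"] that by auto
    moreover have "2 * ((M + 1) div 2) = M \<or> 2 * ((M + 1) div 2) = M + 1" by linarith
    ultimately show ?thesis by (auto simp: le_Suc_eq)
  qed
  finally show ?thesis .
qed

lemma finite_admissible_primes [simp]: "finite (admissible_primes M)"
  by (rule finite_subset[of _ "{..M}"]) (auto simp: admissible_primes_def)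

lemma card_admissible_primes_ge:
  "\<exists>c>0. \<forall>M\<ge>2. admissible_primes M \<noteq> {} \<longrightarrow> real M \<le> c * real (card (admissible_primes M)) * ln (real M)"
proof -
  obtain n0 where n0: "\<And>n. n \<ge> n0 \<Longrightarrow> real n / (4 * ln (2 * real n)) \<le> real (card {p. prime p \<and> n < p \<and> p \<le> 2 * n})"
    using card_primes_doubling_ge by blast
  \<comment> \<open>The entry 16 serves large M: it is 2 * 4 from the doubling bound times 2 from
    ln(2n) \<le> 2 ln M. The other entry serves the finitely many remaining M, where one prime and
    ln M \<ge> ln 2 suffice.\<close>
  define c where "c = max 16 (real (2 * n0 + 3) / ln 2)"
  have "c > 0" unfolding c_def by simp
  moreover have "real M \<le> c * real (card (admissible_primes M)) * ln (real M)"
    if M: "M \<ge> 2" "admissible_primes M \<noteq> {}" for M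
  proof (cases "M \<ge> 2 * n0 + 3")
    case True
    define n where "n = (M + 1) div 2"
    define k where "k = card (admissible_primes M)"
    have n: "n \<ge> n0" "n \<ge> 1" "real M \<le> 2 * real n" "2 * real n \<le> 2 * real M" unfolding n_def using True by linarith+
    have "real n / (4 * ln (2 * real n)) \<le> real k"
      using n0[OF n(1)] True unfolding k_def n_def by (subst admissible_primes_eq) auto
    hence "real n \<le> 4 * real k * ln (2 * real n)" using n by (simp add: field_simps)
    hence "real M \<le> 8 * real k * ln (2 * real n)" using n by simp
    also have "\<dots> \<le> 8 * real k * (2 * ln (real M))"
    proof (intro mult_left_mono)
      have "ln (2 * real n) \<le> ln (2 * real M)" using n M by (subst ln_le_cancel_iff) auto
      also have "\<dots> = ln 2 + ln (real M)" using M by (simp add: ln_mult)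
      also have "\<dots> \<le> 2 * ln (real M)" using M by simp
      finally show "ln (2 * real n) \<le> 2 * ln (real M)" .
    qed auto
    also have "\<dots> = 16 * real k * ln (real M)" by simp
    also have "\<dots> \<le> c * real k * ln (real M)" using M by (intro mult_right_mono) (auto simp: c_def)
    finally show ?thesis unfolding k_def .
  next
    case False
    have k: "real (card (admissible_primes M)) \<ge> 1"
      using M by (simp add: Suc_le_eq card_gt_0_iff)
    have "real M \<le> real (2 * n0 + 3)" using False by simp
    also have "\<dots> \<le> c * ln 2" unfolding c_def by (simp add: max_def field_simps)
    also have "\<dots> \<le> c * ln (real M)" using M \<open>c > 0\<close> by (intro mult_left_mono) auto
    also have "\<dots> \<le> c * ln (real M) * real (card (admissible_primes M))"
      using k M \<open>c > 0\<close> mult_left_mono[OF k, of "c * ln (real M)"] by simp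
    finally show ?thesis by (simp add: mult_ac)
  qed
  ultimately show ?thesis by blast
qed

subsection \<open>Sums of reciprocal weights\<close>

text \<open>Nonnegativity turns summability of the factors into absolute summability, under which a
  product of series may be expanded. It lets sums over integer vectors factor into one-dimensional
  sums.\<close>

lemma has_sum_prod_PiE:
  fixes f :: "'a \<Rightarrow> 'b \<Rightarrow> real"
  assumes "finite A" and "\<And>x. x \<in> A \<Longrightarrow> countable (B x)"
    and nn: "\<And>x y. x \<in> A \<Longrightarrow> y \<in> B x \<Longrightarrow> f x y \<ge> 0"
    and hs: "\<And>x. x \<in> A \<Longrightarrow> (f x has_sum S x) (B x)"
  shows "((\<lambda>g. \<Prod>x\<in>A. f x (g x)) has_sum (\<Prod>x\<in>A. S x)) (PiE A B)"
proof -
  have abs: "(\<lambda>y. norm (f x y)) summable_on B x" if "x \<in> A" for x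
  proof -
    have "f x summable_on B x" using hs[OF that] by (rule has_sum_imp_summable)
    thus ?thesis using nn[OF that] by (subst summable_on_cong[where g = "f x"]) auto
  qed
  have "Infinite_Set_Sum.abs_summable_on (\<lambda>g. \<Prod>x\<in>A. f x (g x)) (PiE A B)"
    using assms abs by (intro abs_summable_on_prod_PiE) (auto simp flip: abs_summable_equivalent)
  hence "(\<lambda>g. \<Prod>x\<in>A. f x (g x)) summable_on PiE A B"
    by (simp add: abs_summable_summable flip: abs_summable_equivalent)
  moreover have "infsum (\<lambda>g. \<Prod>x\<in>A. f x (g x)) (PiE A B) = (\<Prod>x\<in>A. infsum (f x) (B x))"
    using assms(1) abs by (intro infsum_prod_PiE_abs) auto
  moreover have "\<dots> = (\<Prod>x\<in>A. S x)"
    using hs by (intro prod.cong) (auto simp: has_sum_iff)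
  ultimately show ?thesis by (simp add: has_sum_iff)
qed

lemma zeta_real_has_sum:
  assumes "a > 1"
  shows "((\<lambda>n. 1 / real n powr a) has_sum zeta_real a) {1..}"
proof -
  have "summable (\<lambda>n. real n powr (- a))" using assms by (simp add: summable_real_powr_iff)
  hence "summable (\<lambda>n. 1 / real (Suc n) powr a)"
    by (subst summable_Suc_iff) (simp add: powr_minus divide_inverse)
  hence "(\<lambda>n. 1 / real (Suc n) powr a) sums zeta_real a"
    unfolding zeta_real_def by (rule summable_sums)
  hence "((\<lambda>n. 1 / real (Suc n) powr a) has_sum zeta_real a) UNIV"
    by (rule sums_nonneg_imp_has_sum) auto
  moreover have "bij_betw Suc UNIV {1..}"
    by (rule bij_betwI[of _ _ _ "\<lambda>n. n - 1"]) auto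
  ultimately show ?thesis
    using has_sum_reindex_bij_betw[of Suc UNIV "{1..}" "\<lambda>n. 1 / real n powr a" "zeta_real a"] by simp
qed

lemma zeta_real_nonneg: "a > 1 \<Longrightarrow> zeta_real a \<ge> 0"
  by (rule has_sum_nonneg[OF zeta_real_has_sum]) auto

section \<open>Reciprocal weights and their sums over integer vectors\<close>

definition decay_factor :: "real \<Rightarrow> real \<Rightarrow> int \<Rightarrow> real" where
  "decay_factor a c m = (if m = 0 then 1 else c / real_of_int \<bar>m\<bar> powr a)"

definition decay :: "real \<Rightarrow> (nat \<Rightarrow> real) \<Rightarrow> nat \<Rightarrow> (nat \<Rightarrow> int) \<Rightarrow> real" where
  "decay a \<gamma> l h = (\<Prod>j=1..l. decay_factor a (\<gamma> j) (h j))"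

text \<open>Vanishing weights need no exception: if h j is nonzero and \<gamma> j = 0, division by
  zero makes the Korobov product 0, its inverse is again 0, and the corresponding factor of
  \<open>decay\<close> is 0 as well.\<close>

lemma inverse_korobov_weight: "inverse (korobov_weight a \<gamma> l h) = decay a \<gamma> l h"
proof -
  have "decay a \<gamma> l h = (\<Prod>j\<in>{j\<in>{1..l}. h j \<noteq> 0}. decay_factor a (\<gamma> j) (h j))"
    unfolding decay_def by (rule prod.mono_neutral_right) (auto simp: decay_factor_def)
  also have "\<dots> = (\<Prod>j\<in>{j\<in>{1..l}. h j \<noteq> 0}. inverse (real_of_int \<bar>h j\<bar> powr a / \<gamma> j))"
    by (intro prod.cong) (auto simp: decay_factor_def)
  also have "\<dots> = inverse (korobov_weight a \<gamma> l h)"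
    unfolding korobov_weight_def by (rule prod_inversef[unfolded o_def])
  finally show ?thesis ..
qed

lemma decay_factor_nonneg: "c \<ge> 0 \<Longrightarrow> decay_factor a c m \<ge> 0"
  by (simp add: decay_factor_def)

lemma decay_nonneg: "(\<And>j. j \<in> {1..l} \<Longrightarrow> \<gamma> j \<ge> 0) \<Longrightarrow> decay a \<gamma> l h \<ge> 0"
  unfolding decay_def by (intro prod_nonneg ballI decay_factor_nonneg) auto

lemma decay_factor_powr: "c \<ge> 0 \<Longrightarrow> decay_factor a c m powr p = decay_factor (a * p) (c powr p) m"
  by (simp add: decay_factor_def powr_divide powr_powr)

text \<open>Powers of \<open>decay\<close> stay in the same family, with the exponent multiplied and
  the weights raised to the power; so one summation formula serves both the squares and the powers
  1/\<nu>.\<close>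

lemma decay_powr:
  assumes "\<And>j. j \<in> {1..l} \<Longrightarrow> \<gamma> j \<ge> 0"
  shows "decay a \<gamma> l h powr p = decay (a * p) (\<lambda>j. \<gamma> j powr p) l h"
  unfolding decay_def using assms
  by (subst prod_powr_distrib) (auto simp: decay_factor_nonneg decay_factor_powr)

lemma decay_factor_has_sum:
  assumes "a > 1"
  shows "(decay_factor a c has_sum (1 + c * (2 * zeta_real a))) UNIV"
proof -
  let ?f = "decay_factor a c"
  have z: "((\<lambda>n. c * (1 / real n powr a)) has_sum c * zeta_real a) {1..}"
    by (intro has_sum_cmult_right zeta_real_has_sum assms)
  have b1: "bij_betw int {1..} {1..}" by (rule bij_betwI[of _ _ _ nat]) auto
  have b2: "bij_betw (\<lambda>n. - int n) {1..} {..-1}" by (rule bij_betwI[of _ _ _ "\<lambda>m. nat (- m)"]) auto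
  have "((\<lambda>n. ?f (int n)) has_sum c * zeta_real a) {1..}"
    using z by (rule has_sum_cong[THEN iffD1, rotated]) (auto simp: decay_factor_def)
  hence 1: "(?f has_sum c * zeta_real a) {1..}"
    by (rule has_sum_reindex_bij_betw[OF b1, THEN iffD1])
  have "((\<lambda>n. ?f (- int n)) has_sum c * zeta_real a) {1..}"
    using z by (rule has_sum_cong[THEN iffD1, rotated]) (auto simp: decay_factor_def)
  hence 2: "(?f has_sum c * zeta_real a) {..-1}"
    by (rule has_sum_reindex_bij_betw[OF b2, THEN iffD1])
  have 3: "(?f has_sum 1) {0}" by (rule has_sum_finiteI) (auto simp: decay_factor_def)
  have "(?f has_sum (c * zeta_real a + c * zeta_real a)) ({1..} \<union> {..-1})"
    by (rule has_sum_Un_disjoint[OF 1 2]) auto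
  from has_sum_Un_disjoint[OF 3 this] have
    "(?f has_sum (1 + (c * zeta_real a + c * zeta_real a))) ({0} \<union> ({1..} \<union> {..-1}))" by auto
  moreover have "{0} \<union> ({1..} \<union> {..-1}) = (UNIV :: int set)" by auto
  ultimately show ?thesis by (simp add: algebra_simps)
qed

lemma int_vecs_decay_has_sum:
  assumes "a > 1" and "\<And>j. j \<in> {1..l} \<Longrightarrow> \<gamma> j \<ge> 0"
  shows "(decay a \<gamma> l has_sum (\<Prod>j=1..l. 1 + \<gamma> j * (2 * zeta_real a))) (int_vecs l)"
  unfolding decay_def[abs_def] int_vecs_def using assms
  by (intro has_sum_prod_PiE decay_factor_has_sum decay_factor_nonneg) auto

text \<open>The factor 2 - [k j = 0] counts the integers of absolute value k j, so the value agrees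
  with the sum over integer vectors. The same factor is the square of the normalising constant of
  the cosine basis, which is how it arises later.\<close>

lemma nat_vecs_decay_has_sum:
  assumes "a > 1" and "\<And>j. j \<in> {1..l} \<Longrightarrow> \<gamma> j \<ge> 0"
  shows "((\<lambda>k. (\<Prod>j=1..l. 2 - of_bool (k j = 0)) * decay a \<gamma> l (\<lambda>j. int (k j)))
           has_sum (\<Prod>j=1..l. 1 + \<gamma> j * (2 * zeta_real a))) (nat_vecs l)"
proof -
  define f where "f c k = (2 - of_bool (k = 0)) * decay_factor a c (int k)" for c and k :: nat
  have "(f c has_sum (1 + c * (2 * zeta_real a))) UNIV" for c
  proof -
    have "((\<lambda>n. (2 * c) * (1 / real n powr a)) has_sum (2 * c) * zeta_real a) {1..}"
      by (intro has_sum_cmult_right zeta_real_has_sum assms)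
    hence 1: "(f c has_sum (2 * c) * zeta_real a) {1..}"
      by (rule has_sum_cong[THEN iffD1, rotated]) (auto simp: f_def decay_factor_def)
    have 2: "(f c has_sum 1) {0}" by (rule has_sum_finiteI) (auto simp: f_def decay_factor_def)
    from has_sum_Un_disjoint[OF 2 1] have "(f c has_sum (1 + (2 * c) * zeta_real a)) ({0} \<union> {1..})" by simp
    moreover have "{0} \<union> {1..} = (UNIV :: nat set)" by auto
    ultimately show ?thesis by (simp add: mult_ac)
  qed
  moreover have "f c k \<ge> 0" if "c \<ge> 0" for c k
    using that by (auto simp: f_def decay_factor_nonneg)
  ultimately have "((\<lambda>k. \<Prod>j=1..l. f (\<gamma> j) (k j)) has_sum (\<Prod>j=1..l. 1 + \<gamma> j * (2 * zeta_real a))) (nat_vecs l)"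
    unfolding nat_vecs_def using assms(2)
    by (intro has_sum_prod_PiE) auto
  thus ?thesis by (simp add: f_def decay_def prod.distrib)
qed

text \<open>Expanding the product over subsets of coordinates gives the sum in the theorem, and the
  empty subset accounts for the 1.\<close>

lemma weight_zeta_sum_eq:
  "1 + weight_zeta_sum \<alpha> \<gamma> s \<nu> = (\<Prod>j=1..s. 1 + \<gamma> j powr (1 / \<nu>) * (2 * zeta_real (\<alpha> / \<nu>)))"
proof -
  let ?t = "\<lambda>u. (\<Prod>j\<in>u. \<gamma> j) powr (1 / \<nu>) * (2 * zeta_real (\<alpha> / \<nu>)) ^ card u"
  have "(\<Prod>j=1..s. \<gamma> j powr (1 / \<nu>) * (2 * zeta_real (\<alpha> / \<nu>)) + 1)
      = (\<Sum>u\<in>Pow {1..s}. (\<Prod>j\<in>u. \<gamma> j powr (1 / \<nu>) * (2 * zeta_real (\<alpha> / \<nu>))) * (\<Prod>j\<in>{1..s} - u. 1))"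
    by (rule prod_add) simp
  also have "\<dots> = (\<Sum>u\<in>Pow {1..s}. ?t u)"
  proof (intro sum.cong refl)
    fix u assume "u \<in> Pow {1..s}"
    have "(\<Prod>j\<in>u. \<gamma> j) powr (1 / \<nu>) = (\<Prod>j\<in>u. \<gamma> j powr (1 / \<nu>))"
      by (rule prod_powr_distrib)
    thus "(\<Prod>j\<in>u. \<gamma> j powr (1 / \<nu>) * (2 * zeta_real (\<alpha> / \<nu>))) * (\<Prod>j\<in>{1..s} - u. 1) = ?t u"
      by (simp add: prod.distrib)
  qed
  also have "\<dots> = ?t {} + weight_zeta_sum \<alpha> \<gamma> s \<nu>"
    unfolding weight_zeta_sum_def by (rule sum.remove) auto
  finally show ?thesis by (simp add: add.commute)
qed

lemma weight_zeta_sum_mono: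
  assumes "\<alpha> / \<nu> > 1" "l \<le> s"
  shows "weight_zeta_sum \<alpha> \<gamma> l \<nu> \<le> weight_zeta_sum \<alpha> \<gamma> s \<nu>"
  unfolding weight_zeta_sum_def using assms zeta_real_nonneg[OF assms(1)]
  by (intro sum_mono2) auto

lemma weight_zeta_sum_nonneg:
  assumes "\<alpha> / \<nu> > 1"
  shows "weight_zeta_sum \<alpha> \<gamma> s \<nu> \<ge> 0"
  unfolding weight_zeta_sum_def using zeta_real_nonneg[OF assms] by (intro sum_nonneg) auto

text \<open>This interprets the subset sum of the theorem as a total of reciprocal weights: the zero
  vector has decay 1, which cancels the 1 in \<open>weight_zeta_sum_eq\<close>.\<close>

lemma int_vecs_decay_powr_has_sum:
  assumes "\<alpha> / \<nu> > 1" and "\<And>j. j \<in> {1..l} \<Longrightarrow> \<gamma> j \<ge> 0"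
  shows "((\<lambda>h. decay \<alpha> \<gamma> l h powr (1 / \<nu>)) has_sum weight_zeta_sum \<alpha> \<gamma> l \<nu>) (int_vecs l - {\<lambda>j\<in>{1..l}. 0})"
proof -
  let ?f = "\<lambda>h. decay \<alpha> \<gamma> l h powr (1 / \<nu>)"
  have "(?f has_sum (\<Prod>j=1..l. 1 + \<gamma> j powr (1 / \<nu>) * (2 * zeta_real (\<alpha> / \<nu>)))) (int_vecs l)"
    using int_vecs_decay_has_sum[of "\<alpha> / \<nu>" l "\<lambda>j. \<gamma> j powr (1 / \<nu>)"] assms(1)
      decay_powr[of l \<gamma> \<alpha> _ "1 / \<nu>", OF assms(2)] by simp
  hence "(?f has_sum (1 + weight_zeta_sum \<alpha> \<gamma> l \<nu>)) (int_vecs l)"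
    unfolding weight_zeta_sum_eq .
  moreover have "(?f has_sum 1) {\<lambda>j\<in>{1..l}. 0}"
    by (rule has_sum_finiteI) (auto simp: decay_def decay_factor_def)
  ultimately have "(?f has_sum (1 + weight_zeta_sum \<alpha> \<gamma> l \<nu> - 1)) (int_vecs l - {\<lambda>j\<in>{1..l}. 0})"
    by (rule has_sum_Diff) (auto simp: int_vecs_def)
  thus ?thesis by simp
qed

lemma nat_vecs_decay_powr_has_sum:
  assumes "\<alpha> / \<nu> > 1" and "\<And>j. j \<in> {1..l} \<Longrightarrow> \<gamma> j \<ge> 0"
  shows "((\<lambda>k. (\<Prod>j=1..l. 2 - of_bool (k j = 0)) * decay \<alpha> \<gamma> l (\<lambda>j. int (k j)) powr (1 / \<nu>))
           has_sum weight_zeta_sum \<alpha> \<gamma> l \<nu>) (nat_vecs l - {\<lambda>j\<in>{1..l}. 0})"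
proof -
  let ?f = "\<lambda>k. (\<Prod>j=1..l. 2 - of_bool (k j = 0)) * decay \<alpha> \<gamma> l (\<lambda>j. int (k j)) powr (1 / \<nu>)"
  have "(?f has_sum (\<Prod>j=1..l. 1 + \<gamma> j powr (1 / \<nu>) * (2 * zeta_real (\<alpha> / \<nu>)))) (nat_vecs l)"
    using nat_vecs_decay_has_sum[of "\<alpha> / \<nu>" l "\<lambda>j. \<gamma> j powr (1 / \<nu>)"] assms(1)
      decay_powr[of l \<gamma> \<alpha> _ "1 / \<nu>", OF assms(2)] by simp
  hence "(?f has_sum (1 + weight_zeta_sum \<alpha> \<gamma> l \<nu>)) (nat_vecs l)"
    unfolding weight_zeta_sum_eq .
  moreover have "(?f has_sum 1) {\<lambda>j\<in>{1..l}. 0}"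
    by (rule has_sum_finiteI) (auto simp: decay_def decay_factor_def)
  ultimately have "(?f has_sum (1 + weight_zeta_sum \<alpha> \<gamma> l \<nu> - 1)) (nat_vecs l - {\<lambda>j\<in>{1..l}. 0})"
    by (rule has_sum_Diff) (auto simp: nat_vecs_def)
  thus ?thesis by simp
qed

subsection \<open>Dual lattices of component-by-component vectors\<close>

lemma has_sum_finite_sum:
  fixes f :: "'i \<Rightarrow> 'a \<Rightarrow> 'b :: topological_comm_monoid_add"
  assumes "finite I" "\<And>i. i \<in> I \<Longrightarrow> (f i has_sum S i) A"
  shows "((\<lambda>x. \<Sum>i\<in>I. f i x) has_sum (\<Sum>i\<in>I. S i)) A"
  using assms by (induction I rule: finite_induct) (auto intro!: has_sum_add)

text \<open>Often called Jensen's inequality for sums. With S the sum of the q-th powers, f^q \<le>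
  S gives f = f^q f^(1-q) \<le> f^q S^((1-q)/q) pointwise; summing yields at most S^(1/q).\<close>

lemma infsum_le_powr:
  fixes f :: "'a \<Rightarrow> real"
  assumes q: "0 < q" "q \<le> 1" and nn: "\<And>x. x \<in> D \<Longrightarrow> f x \<ge> 0"
    and s: "f summable_on D" "(\<lambda>x. f x powr q) summable_on D"
  shows "infsum f D powr q \<le> (\<Sum>\<^sub>\<infinity>x\<in>D. f x powr q)"
proof -
  define S where "S = (\<Sum>\<^sub>\<infinity>x\<in>D. f x powr q)"
  have S0: "S \<ge> 0" unfolding S_def by (intro infsum_nonneg) auto
  have le: "f x \<le> f x powr q * S powr ((1 - q) / q)" if x: "x \<in> D" for x
  proof (cases "f x = 0")
    case False
    hence pos: "f x > 0" using nn[OF x] by simp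
    have "f x powr q \<le> S"
      using finite_sum_le_infsum[OF s(2), of "{x}"] x by (simp add: S_def)
    hence "(f x powr q) powr ((1 - q) / q) \<le> S powr ((1 - q) / q)"
      using q by (intro powr_mono2) auto
    hence "f x powr q * f x powr (1 - q) \<le> f x powr q * S powr ((1 - q) / q)"
      using q by (intro mult_left_mono) (auto simp: powr_powr)
    thus ?thesis using pos by (simp flip: powr_add)
  qed simp
  have "infsum f D \<le> (\<Sum>\<^sub>\<infinity>x\<in>D. f x powr q * S powr ((1 - q) / q))"
    using s le by (intro infsum_mono summable_on_cmult_left) auto
  also have "\<dots> = S * S powr ((1 - q) / q)"
    unfolding S_def using s by (intro infsum_cmult_left) auto
  also have "\<dots> = S powr (1 / q)"
  proof (cases "S = 0")
    case False
    hence "S * S powr ((1 - q) / q) = S powr (1 + (1 - q) / q)"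
      using S0 by (simp add: powr_add)
    also have "1 + (1 - q) / q = 1 / q" using q by (simp add: field_simps)
    finally show ?thesis .
  qed simp
  finally have "infsum f D powr q \<le> (S powr (1 / q)) powr q"
    using q nn by (intro powr_mono2) (auto intro: infsum_nonneg)
  thus ?thesis using q S0 by (simp add: powr_powr S_def)
qed

text \<open>If c sits at index i < t of the sorted list, every entry from index i on has at least
  its key. There are length - i of these, and i \<le> t - 1 gives the additional 1.\<close>

lemma length_le_card_sort_key_ge:
  fixes f :: "'a \<Rightarrow> 'b :: linorder"
  assumes c: "c \<in> set (take t (sort_key f xs))" and d: "distinct xs"
  shows "length xs + 1 \<le> t + card {x\<in>set xs. f c \<le> f x}"
proof -
  define ys where "ys = sort_key f xs"
  obtain i where i: "i < t" "i < length ys" "ys ! i = c"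
    using c by (auto simp: in_set_conv_nth ys_def)
  have so: "sorted (map f ys)" unfolding ys_def by simp
  have "set (drop i ys) \<subseteq> {x\<in>set xs. f c \<le> f x}"
  proof
    fix x assume "x \<in> set (drop i ys)"
    then obtain k where "k < length (drop i ys)" "x = drop i ys ! k"
      unfolding in_set_conv_nth by metis
    hence k: "i + k < length ys" "x = ys ! (i + k)" by auto
    have "map f ys ! i \<le> map f ys ! (i + k)"
      using so k by (intro sorted_nth_mono) auto
    moreover have "x \<in> set ys" using k by simp
    ultimately show "x \<in> {x\<in>set xs. f c \<le> f x}" using i k by (simp add: ys_def)
  qed
  hence "card (set (drop i ys)) \<le> card {x\<in>set xs. f c \<le> f x}"
    by (intro card_mono) auto
  moreover have "distinct ys" using d by (simp add: ys_def)
  hence "card (set (drop i ys)) = length ys - i" by (simp add: distinct_card)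
  ultimately show ?thesis using i by (simp add: ys_def)
qed

section \<open>Averaging over the last component of a generating vector\<close>

lemma dual_lattice_cong:
  assumes "\<And>j. j \<in> {1..l} \<Longrightarrow> z j = z' j"
  shows "dual_lattice l N z = dual_lattice l N z'"
proof -
  have "(\<Sum>j=1..l. k j * int (z j)) = (\<Sum>j=1..l. k j * int (z' j))" for k
    using assms by (intro sum.cong) auto
  thus ?thesis unfolding dual_lattice_def by simp
qed

lemma lattice_merit_cong:
  assumes "\<And>j. j \<in> {1..l} \<Longrightarrow> z j = z' j"
  shows "lattice_merit \<alpha> \<gamma> N l z = lattice_merit \<alpha> \<gamma> N l z'"
  unfolding lattice_merit_def using dual_lattice_cong[OF assms] by simp

lemma dual_lattice_update_iff:
  assumes "l \<ge> 1"
  shows "h \<in> dual_lattice l N (z(l := c)) \<longleftrightarrow>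
    h \<in> int_vecs l \<and> int N dvd (\<Sum>j=1..l - 1. h j * int (z j)) + h l * int c"
proof -
  obtain m where m: "l = Suc m" using assms by (cases l) auto
  have "(\<Sum>j=1..l. h j * int ((z(l := c)) j)) = (\<Sum>j=1..l - 1. h j * int (z j)) + h l * int c"
    unfolding m by (simp add: sum.nat_ivl_Suc')
  thus ?thesis unfolding dual_lattice_def by (simp add: cong_0_iff)
qed

lemma decay_sq: "(decay \<alpha> \<gamma> l h)\<^sup>2 = 1 / (korobov_weight \<alpha> \<gamma> l h)\<^sup>2"
  by (simp add: inverse_korobov_weight[symmetric] power_inverse divide_inverse)

lemma decay_sq_summable:
  assumes "\<alpha> > 1 / 2" "\<And>j. j \<in> {1..l} \<Longrightarrow> \<gamma> j \<ge> 0"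
  shows "(\<lambda>h. (decay \<alpha> \<gamma> l h)\<^sup>2) summable_on int_vecs l"
proof -
  have "(\<lambda>h. (decay \<alpha> \<gamma> l h)\<^sup>2) = decay (\<alpha> * 2) (\<lambda>j. \<gamma> j powr 2) l"
  proof
    fix h
    show "(decay \<alpha> \<gamma> l h)\<^sup>2 = decay (\<alpha> * 2) (\<lambda>j. \<gamma> j powr 2) l h"
      using decay_powr[of l \<gamma> \<alpha> h 2, OF assms(2)] decay_nonneg[of l \<gamma> \<alpha> h, OF assms(2)] by (simp add: powr_numeral)
  qed
  thus ?thesis
    using int_vecs_decay_has_sum[of "\<alpha> * 2" l "\<lambda>j. \<gamma> j powr 2"] assms(1) by (auto dest: has_sum_imp_summable)
qed

text \<open>Vectors with h l = 0 lie in the dual lattice independently of c, so their share R is a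
  constant. Ranking candidates by merit is therefore ranking them by the contribution of vectors
  with h l nonzero.\<close>

lemma lattice_merit_split:
  assumes l: "l \<ge> 1" and a: "\<alpha> > 1 / 2" "\<And>j. j \<in> {1..l} \<Longrightarrow> \<gamma> j \<ge> 0"
  shows "\<exists>R. \<forall>c. lattice_merit \<alpha> \<gamma> N l (z(l := c)) =
    R + (\<Sum>\<^sub>\<infinity>h\<in>{h\<in>dual_lattice l N (z(l := c)). h l \<noteq> 0}. (decay \<alpha> \<gamma> l h)\<^sup>2)"
proof (intro exI allI)
  fix c
  \<comment> \<open>The value 0 at position l is arbitrary, since it is multiplied by h l =
    0.\<close>
  let ?A = "{h\<in>dual_lattice l N (z(l := 0)). h l = 0} - {\<lambda>j\<in>{1..l}. 0}"
  let ?D = "{h\<in>dual_lattice l N (z(l := c)). h l \<noteq> 0}"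
  have e: "dual_lattice l N (z(l := c)) - {\<lambda>j\<in>{1..l}. 0} = ?A \<union> ?D"
    using l by (auto simp: dual_lattice_update_iff)
  have sub: "?A \<subseteq> int_vecs l" "?D \<subseteq> int_vecs l"
    by (auto simp: dual_lattice_def)
  show "lattice_merit \<alpha> \<gamma> N l (z(l := c)) = (\<Sum>\<^sub>\<infinity>h\<in>?A. (decay \<alpha> \<gamma> l h)\<^sup>2) + (\<Sum>\<^sub>\<infinity>h\<in>?D. (decay \<alpha> \<gamma> l h)\<^sup>2)"
    unfolding lattice_merit_def e decay_sq[symmetric]
    using summable_on_subset_banach[OF decay_sq_summable[OF a] sub(1)]
      summable_on_subset_banach[OF decay_sq_summable[OF a] sub(2)]
    by (intro infsum_Un_disjoint) auto
qed

text \<open>A linear congruence modulo a prime with invertible coefficient has at most one solution;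
  if the coefficient vanishes modulo N, the trivial count N - 1 is used.\<close>

lemma card_dual_lattice_last_component:
  assumes N: "prime N" and l: "l \<ge> 1"
  shows "real (card {c\<in>{1..<N}. h \<in> dual_lattice l N (z(l := c))})
    \<le> 1 + of_bool (int N dvd h l) * (real N - 1)"
proof (cases "int N dvd h l")
  case True
  have "card {c\<in>{1..<N}. h \<in> dual_lattice l N (z(l := c))} \<le> card {1..<N}"
    by (intro card_mono) auto
  thus ?thesis using True by simp
next
  case False
  have "c = c'" if "c \<in> {1..<N}" "c' \<in> {1..<N}"
    "h \<in> dual_lattice l N (z(l := c))" "h \<in> dual_lattice l N (z(l := c'))" for c c'
  proof -
    let ?S = "\<Sum>j=1..l - 1. h j * int (z j)"
    have "int N dvd (?S + h l * int c) - (?S + h l * int c')"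
      using that(3,4) unfolding dual_lattice_update_iff[OF l] by (intro dvd_diff) simp_all
    hence "int N dvd h l * (int c - int c')" by (simp add: right_diff_distrib)
    hence "int N dvd int c - int c'"
      using False N by (auto simp: prime_dvd_mult_iff)
    moreover have "\<bar>int c - int c'\<bar> < int N" using that(1,2) by auto
    ultimately have "int c - int c' = 0"
      using zdvd_not_zless[of "\<bar>int c - int c'\<bar>" "int N"] by (cases "int c - int c' = 0") auto
    thus ?thesis by simp
  qed
  hence "card {c\<in>{1..<N}. h \<in> dual_lattice l N (z(l := c))} \<le> Suc 0"
    by (subst card_le_Suc0_iff_eq) auto
  thus ?thesis using False by simp
qed

text \<open>After exchanging the sums, each h with h l not divisible by N is counted at most once
  and the others at most N - 1 times. The latter come from arbitrary h by multiplying the last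
  component by N, which shrinks the summand by N^(\<alpha>/\<open>lam\<close>) and so makes up for
  the multiplicity. Each of the two parts is at most the full sum.\<close>

lemma sum_dual_lattice_decay_le:
  assumes N: "prime N" and l: "l \<ge> 1" and lam: "0 < lam" "lam < \<alpha>"
    and \<gamma>: "\<And>j. j \<in> {1..l} \<Longrightarrow> \<gamma> j \<ge> 0"
  shows "(\<Sum>c\<in>{1..<N}. \<Sum>\<^sub>\<infinity>h\<in>{h\<in>dual_lattice l N (z(l := c)). h l \<noteq> 0}. decay \<alpha> \<gamma> l h powr (1 / lam))
    \<le> 2 * weight_zeta_sum \<alpha> \<gamma> l lam"
proof -
  define w where "w h = decay \<alpha> \<gamma> l h powr (1 / lam)" for h
  define W where "W = weight_zeta_sum \<alpha> \<gamma> l lam"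
  define E where "E = {h\<in>int_vecs l. h l \<noteq> 0}"
  define E' where "E' = {h\<in>E. int N dvd h l}"
  define D where "D c = {h\<in>dual_lattice l N (z(l := c)). h l \<noteq> 0}" for c
  have N0: "N > 0" using N prime_gt_0_nat by blast
  have a: "\<alpha> / lam > 1" using lam by simp
  have w0: "w h \<ge> 0" for h unfolding w_def by simp
  have DE: "D c \<subseteq> E" for c unfolding D_def E_def dual_lattice_def by auto
  have Esub: "E \<subseteq> int_vecs l - {\<lambda>j\<in>{1..l}. 0}" using l by (auto simp: E_def)
  have hs: "(w has_sum W) (int_vecs l - {\<lambda>j\<in>{1..l}. 0})"
    unfolding w_def W_def by (rule int_vecs_decay_powr_has_sum[OF a \<gamma>])
  have sE: "w summable_on E" using has_sum_imp_summable[OF hs] Esub by (rule summable_on_subset_banach)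
  have WE: "infsum w E \<le> W"
  proof -
    have "infsum w E \<le> infsum w (int_vecs l - {\<lambda>j\<in>{1..l}. 0})"
      using sE has_sum_imp_summable[OF hs] Esub w0 by (intro infsum_mono_neutral) auto
    thus ?thesis using hs by (simp add: infsumI)
  qed
  have sE': "w summable_on E'" using sE by (rule summable_on_subset_banach) (auto simp: E'_def)

  define \<phi> where "\<phi> h = h(l := int N * h l)" for h :: "nat \<Rightarrow> int"
  have bij: "bij_betw \<phi> E E'"
  proof (rule bij_betwI[of _ _ _ "\<lambda>h. h(l := h l div int N)"])
    show "\<phi> \<in> E \<rightarrow> E'" using N0 l by (auto simp: \<phi>_def E_def E'_def int_vecs_def PiE_iff extensional_def)
    show "(\<lambda>h. h(l := h l div int N)) \<in> E' \<rightarrow> E"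
      using N0 l by (auto simp: E_def E'_def int_vecs_def PiE_iff extensional_def dvd_div_eq_0_iff)
  qed (use N0 in \<open>auto simp: \<phi>_def E'_def\<close>)
  have w\<phi>: "(real N - 1) * w (\<phi> h) \<le> w h" if "h \<in> E" for h
  proof -
    obtain m where m: "l = Suc m" using l by (cases l) auto
    have "decay \<alpha> \<gamma> l (\<phi> h) = decay \<alpha> \<gamma> l h / real N powr \<alpha>"
    proof -
      have "(\<Prod>j=1..m. decay_factor \<alpha> (\<gamma> j) (\<phi> h j)) = (\<Prod>j=1..m. decay_factor \<alpha> (\<gamma> j) (h j))"
        by (intro prod.cong) (auto simp: \<phi>_def m)
      moreover have "decay_factor \<alpha> (\<gamma> l) (\<phi> h l) = decay_factor \<alpha> (\<gamma> l) (h l) / real N powr \<alpha>"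
        using that N0 by (auto simp: \<phi>_def E_def decay_factor_def abs_mult powr_mult)
      ultimately show ?thesis unfolding decay_def m by (simp add: prod.nat_ivl_Suc')
    qed
    hence "w (\<phi> h) = w h / real N powr (\<alpha> / lam)"
      unfolding w_def using decay_nonneg[of l \<gamma> \<alpha> h, OF \<gamma>] by (simp add: powr_divide powr_powr)
    moreover have "real N - 1 \<le> real N powr (\<alpha> / lam)"
    proof -
      have "real N powr 1 \<le> real N powr (\<alpha> / lam)" using N0 a by (intro powr_mono) auto
      thus ?thesis by simp
    qed
    hence "(real N - 1) * w (\<phi> h) \<le> real N powr (\<alpha> / lam) * w (\<phi> h)"
      by (intro mult_right_mono w0)
    ultimately show ?thesis using N0 by simp
  qed
  have E'le: "(real N - 1) * infsum w E' \<le> W"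
  proof -
    have "(real N - 1) * infsum w E' = (\<Sum>\<^sub>\<infinity>h\<in>E. (real N - 1) * w (\<phi> h))"
      using infsum_reindex_bij_betw[OF bij, of w] by (simp add: infsum_cmult_right')
    also have "\<dots> \<le> infsum w E"
      using sE sE' w\<phi> summable_on_reindex_bij_betw[OF bij, of w]
      by (intro infsum_mono summable_on_cmult_right) auto
    finally show ?thesis using WE by simp
  qed

  have 1: "((\<lambda>h. of_bool (h \<in> D c) * w h) has_sum infsum w (D c)) E" for c
  proof -
    have "(w has_sum infsum w (D c)) (D c)"
      using summable_on_subset_banach[OF sE DE[of c]] by simp
    thus ?thesis
      using DE[of c] by (subst (asm) has_sum_cong_neutral[where T = E and g = "\<lambda>h. of_bool (h \<in> D c) * w h"]) auto
  qed
  have 2: "((\<lambda>h. \<Sum>c\<in>{1..<N}. of_bool (h \<in> D c) * w h) has_sum (\<Sum>c\<in>{1..<N}. infsum w (D c))) E"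
    by (intro has_sum_finite_sum 1) auto
  have 3: "((\<lambda>h. w h + (real N - 1) * (of_bool (h \<in> E') * w h)) has_sum (infsum w E + (real N - 1) * infsum w E')) E"
  proof (intro has_sum_add has_sum_cmult_right)
    have "(w has_sum infsum w E') E'" using sE' by simp
    thus "((\<lambda>h. of_bool (h \<in> E') * w h) has_sum infsum w E') E"
      by (subst (asm) has_sum_cong_neutral[where T = E and g = "\<lambda>h. of_bool (h \<in> E') * w h"]) (auto simp: E'_def)
  qed (use sE in auto)
  have "(\<Sum>c\<in>{1..<N}. infsum w (D c)) \<le> infsum w E + (real N - 1) * infsum w E'"
  proof (rule has_sum_mono[OF 2 3])
    fix h assume h: "h \<in> E"
    have "(\<Sum>c\<in>{1..<N}. of_bool (h \<in> D c) * w h) = real (card {c\<in>{1..<N}. h \<in> dual_lattice l N (z(l := c))}) * w h"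
      using h by (simp add: D_def E_def Int_def flip: sum_distrib_right)
    also have "\<dots> \<le> (1 + of_bool (int N dvd h l) * (real N - 1)) * w h"
      using card_dual_lattice_last_component[OF N l] w0 by (intro mult_right_mono)
    also have "\<dots> = w h + (real N - 1) * (of_bool (h \<in> E') * w h)"
      using h by (simp add: E'_def algebra_simps)
    finally show "(\<Sum>c\<in>{1..<N}. of_bool (h \<in> D c) * w h) \<le> w h + (real N - 1) * (of_bool (h \<in> E') * w h)" .
  qed
  also have "\<dots> \<le> 2 * W" using WE E'le by simp
  finally show ?thesis unfolding D_def w_def W_def .
qed


lemma length_cbc_candidates_le:
  assumes "prime N" "0 < \<tau>" "\<tau> < 1"
  shows "real (nat \<lceil>\<tau> * (real N - 1)\<rceil>) < \<tau> * (real N - 1) + 1"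
    and "nat \<lceil>\<tau> * (real N - 1)\<rceil> \<le> N - 1"
    and "nat \<lceil>\<tau> * (real N - 1)\<rceil> \<ge> 1"
proof -
  have N: "real N - 1 > 0" using prime_gt_1_nat[OF assms(1)] by simp
  show "real (nat \<lceil>\<tau> * (real N - 1)\<rceil>) < \<tau> * (real N - 1) + 1"
    using N assms by (simp add: of_nat_nat) linarith
  have "\<tau> * (real N - 1) \<le> 1 * (real N - 1)" using N assms by (intro mult_right_mono) auto
  also have "\<dots> = of_int (int (N - 1))" using N by (simp add: of_nat_diff)
  finally show "nat \<lceil>\<tau> * (real N - 1)\<rceil> \<le> N - 1" by (simp add: nat_le_iff ceiling_le_iff)
  have "\<tau> * (real N - 1) > 0" using N assms by simp
  thus "nat \<lceil>\<tau> * (real N - 1)\<rceil> \<ge> 1" by linarith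
qed

text \<open>The contribution of the chosen z l is at least decay(h)^2, and at least (1 - \<tau>)(N -
  1) values of c have a contribution no smaller. Jensen's inequality turns this into a lower bound
  on the sum over c of the powers 1/\<open>lam\<close>, which the averaging bound limits from
  above.\<close>

lemma cbc_decay_le_last:
  assumes N: "prime N" and \<tau>: "0 < \<tau>" "\<tau> < 1" and lam: "1 / 2 < lam" "lam < \<alpha>"
    and \<gamma>: "\<And>j. j \<in> {1..l} \<Longrightarrow> \<gamma> j \<ge> 0"
    and z: "z \<in> cbc_vectors \<alpha> \<gamma> \<tau> s N" and l: "1 \<le> l" "l \<le> s"
    and h: "h \<in> dual_lattice l N z" "h l \<noteq> 0"
  shows "(1 - \<tau>) * (real N - 1) * decay \<alpha> \<gamma> l h powr (1 / lam) \<le> 2 * weight_zeta_sum \<alpha> \<gamma> l lam"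
proof -
  define D where "D c = {h\<in>dual_lattice l N (z(l := c)). h l \<noteq> 0}" for c
  define \<theta> where "\<theta> c = (\<Sum>\<^sub>\<infinity>h\<in>D c. (decay \<alpha> \<gamma> l h)\<^sup>2)" for c
  define G where "G = {c\<in>{1..<N}. \<theta> (z l) \<le> \<theta> c}"
  define d where "d = decay \<alpha> \<gamma> l h powr (1 / lam)"
  have N1: "N > 1" using N prime_gt_1_nat by blast
  have hD: "h \<in> D (z l)" using h by (simp add: D_def)
  have Dsub: "D c \<subseteq> int_vecs l" for c by (auto simp: D_def dual_lattice_def)
  have a: "\<alpha> > 1 / 2" using lam by simp
  have dn: "decay \<alpha> \<gamma> l h \<ge> 0" for h by (rule decay_nonneg[OF \<gamma>])
  have "z l \<in> {1..N - 1}" using z l by (auto simp: cbc_vectors_def PiE_iff)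
  hence zl: "z l \<in> {1..<N}" using N1 by auto

  \<comment> \<open>The left side equals (1 - \<tau>)(N - 1): the rounding up in the number of
    candidates costs 1, and the rank bound regains it.\<close>
  have G: "real N - 1 - (\<tau> * (real N - 1) + 1) + 1 \<le> real (card G)"
  proof (cases "l = 1")
    case True
    \<comment> \<open>The first component is fixed, not selected by merit, but in dimension 1 all c
      are equivalent: c is invertible modulo N and drops out of the congruence.\<close>
    have D: "D c = {h\<in>int_vecs l. int N dvd h l \<and> h l \<noteq> 0}" if "c \<in> {1..<N}" for c
    proof -
      have "\<not> int N dvd int c"
        using that nat_dvd_not_less[of c N] by auto
      hence "int N dvd h l * int c \<longleftrightarrow> int N dvd h l" for h :: "nat \<Rightarrow> int"
        using N by (simp add: prime_dvd_mult_iff)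
      thus ?thesis unfolding D_def dual_lattice_update_iff[OF l(1)] by (simp add: True conj_assoc)
    qed
    have "\<theta> c = \<theta> (z l)" if "c \<in> {1..<N}" for c
      unfolding \<theta>_def D[OF that] D[OF zl] ..
    hence "G = {1..<N}" by (auto simp: G_def)
    thus ?thesis using \<tau> N1 by (simp add: of_nat_diff)
  next
    case False
    define y where "y = restrict z {1..l - 1}"
    define t where "t = nat \<lceil>\<tau> * (real N - 1)\<rceil>"
    have eq: "lattice_merit \<alpha> \<gamma> N l (y(l := c)) = lattice_merit \<alpha> \<gamma> N l (z(l := c))" for c
      by (rule lattice_merit_cong) (auto simp: y_def)
    obtain R where R: "\<And>c. lattice_merit \<alpha> \<gamma> N l (z(l := c)) = R + \<theta> c"
      using lattice_merit_split[of l \<alpha> \<gamma> N z, OF l(1) a \<gamma>] unfolding \<theta>_def D_def by auto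
    have "z l \<in> cbc_candidates \<alpha> \<gamma> \<tau> N l y"
      using z l False by (auto simp: cbc_vectors_def y_def)
    hence "z l \<in> set (take t (sort_key (\<lambda>c. R + \<theta> c) [1..<N]))"
      unfolding cbc_candidates_def t_def eq R .
    from length_le_card_sort_key_ge[OF this] have "N \<le> t + card G"
      using N1 by (simp add: G_def)
    moreover have "real t < \<tau> * (real N - 1) + 1"
      unfolding t_def by (rule length_cbc_candidates_le[OF N \<tau>])
    ultimately show ?thesis by linarith
  qed

  have d: "d \<le> (\<Sum>\<^sub>\<infinity>h\<in>D c. decay \<alpha> \<gamma> l h powr (1 / lam))" if "c \<in> G" for c
  proof -
    \<comment> \<open>Here \<open>lam\<close> > 1/2 enters: it makes the exponent at most 1, and
      applied to squares the exponent produces the power 1/\<open>lam\<close>.\<close>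
    let ?q = "1 / (2 * lam)"
    have pw: "((decay \<alpha> \<gamma> l h)\<^sup>2) powr ?q = decay \<alpha> \<gamma> l h powr (1 / lam)" for h
      using dn[of h] by (simp add: powr_powr flip: powr_numeral)
    have s: "(\<lambda>h. (decay \<alpha> \<gamma> l h)\<^sup>2) summable_on D c" for c
      using decay_sq_summable[OF a \<gamma>] Dsub by (rule summable_on_subset_banach)
    have "(decay \<alpha> \<gamma> l h)\<^sup>2 \<le> \<theta> (z l)"
      using finite_sum_le_infsum[OF s[of "z l"], of "{h}"] hD by (simp add: \<theta>_def)
    also have "\<dots> \<le> \<theta> c" using that by (simp add: G_def)
    finally have "((decay \<alpha> \<gamma> l h)\<^sup>2) powr ?q \<le> \<theta> c powr ?q"
      using lam by (intro powr_mono2) auto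
    also have "\<dots> \<le> (\<Sum>\<^sub>\<infinity>h\<in>D c. ((decay \<alpha> \<gamma> l h)\<^sup>2) powr ?q)"
      unfolding \<theta>_def
    proof (rule infsum_le_powr)
      have "(\<lambda>h. decay \<alpha> \<gamma> l h powr (1 / lam)) summable_on int_vecs l - {\<lambda>j\<in>{1..l}. 0}"
        using int_vecs_decay_powr_has_sum[of \<alpha> lam l \<gamma>] lam \<gamma> by (intro has_sum_imp_summable) auto
      hence "(\<lambda>h. decay \<alpha> \<gamma> l h powr (1 / lam)) summable_on D c"
        by (rule summable_on_subset_banach) (use Dsub[of c] l in \<open>auto simp: D_def\<close>)
      thus "(\<lambda>h. ((decay \<alpha> \<gamma> l h)\<^sup>2) powr ?q) summable_on D c" by (simp only: pw)
    qed (use lam s in auto)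
    finally show ?thesis unfolding pw d_def .
  qed

  have "(1 - \<tau>) * (real N - 1) * d \<le> real (card G) * d"
    using G by (intro mult_right_mono) (auto simp: d_def algebra_simps)
  also have "\<dots> = (\<Sum>c\<in>G. d)" by simp
  also have "\<dots> \<le> (\<Sum>c\<in>G. \<Sum>\<^sub>\<infinity>h\<in>D c. decay \<alpha> \<gamma> l h powr (1 / lam))"
    by (intro sum_mono d)
  also have "\<dots> \<le> (\<Sum>c\<in>{1..<N}. \<Sum>\<^sub>\<infinity>h\<in>D c. decay \<alpha> \<gamma> l h powr (1 / lam))"
    by (intro sum_mono2 infsum_nonneg) (auto simp: G_def)
  also have "\<dots> \<le> 2 * weight_zeta_sum \<alpha> \<gamma> l lam"
    unfolding D_def using lam by (intro sum_dual_lattice_decay_le[OF N l(1) _ _ \<gamma>]) auto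
  finally show ?thesis unfolding d_def .
qed

text \<open>Cutting h off after its last nonzero component l changes neither the congruence nor the
  decay, so the bound for a nonzero last component applies in dimension l.\<close>

lemma cbc_decay_le:
  assumes N: "prime N" and \<tau>: "0 < \<tau>" "\<tau> < 1" and lam: "1 / 2 < lam" "lam < \<alpha>"
    and \<gamma>: "\<And>j. j \<in> {1..s} \<Longrightarrow> \<gamma> j \<ge> 0"
    and z: "z \<in> cbc_vectors \<alpha> \<gamma> \<tau> s N"
    and h: "h \<in> dual_lattice s N z" "j \<in> {1..s}" "h j \<noteq> 0"
  shows "(1 - \<tau>) * (real N - 1) * decay \<alpha> \<gamma> s h powr (1 / lam) \<le> 2 * weight_zeta_sum \<alpha> \<gamma> s lam"
proof -
  define l where "l = Max {j\<in>{1..s}. h j \<noteq> 0}"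
  have fin: "finite {j\<in>{1..s}. h j \<noteq> 0}" by simp
  have "l \<in> {j\<in>{1..s}. h j \<noteq> 0}" unfolding l_def using h by (intro Max_in) auto
  hence l: "1 \<le> l" "l \<le> s" "h l \<noteq> 0" by auto
  have above: "h i = 0" if "i \<in> {1..s} - {1..l}" for i
    using Max_ge[OF fin, of i] that unfolding l_def by fastforce
  have "(\<Sum>j=1..s. h j * int (z j)) = (\<Sum>j=1..l. h j * int (z j))"
    using l above by (intro sum.mono_neutral_right) auto
  also have "\<dots> = (\<Sum>j=1..l. restrict h {1..l} j * int (z j))"
    by (intro sum.cong) auto
  finally have "restrict h {1..l} \<in> dual_lattice l N z"
    using h by (simp add: dual_lattice_def int_vecs_def)
  moreover have "decay \<alpha> \<gamma> s h = decay \<alpha> \<gamma> l (restrict h {1..l})"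
  proof -
    have "decay \<alpha> \<gamma> s h = (\<Prod>j=1..l. decay_factor \<alpha> (\<gamma> j) (h j))"
      unfolding decay_def using l above by (intro prod.mono_neutral_right) (auto simp: decay_factor_def)
    also have "\<dots> = decay \<alpha> \<gamma> l (restrict h {1..l})"
      unfolding decay_def by (intro prod.cong) auto
    finally show ?thesis .
  qed
  ultimately have "(1 - \<tau>) * (real N - 1) * decay \<alpha> \<gamma> s h powr (1 / lam) \<le> 2 * weight_zeta_sum \<alpha> \<gamma> l lam"
    using cbc_decay_le_last[OF N \<tau> lam _ z l(1,2), of "restrict h {1..l}"] l \<gamma> by auto
  also have "\<dots> \<le> 2 * weight_zeta_sum \<alpha> \<gamma> s lam"
    using weight_zeta_sum_mono[of \<alpha> lam l s \<gamma>] lam l by simp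
  finally show ?thesis .
qed

subsection \<open>Counting generating vectors\<close>

lemma cbc_candidates:
  assumes "prime N" "0 < \<tau>" "\<tau> < 1"
  shows "cbc_candidates \<alpha> \<gamma> \<tau> N l z \<subseteq> {1..N - 1}"
    and "card (cbc_candidates \<alpha> \<gamma> \<tau> N l z) = nat \<lceil>\<tau> * (real N - 1)\<rceil>"
proof -
  let ?t = "nat \<lceil>\<tau> * (real N - 1)\<rceil>"
  let ?xs = "sort_key (\<lambda>c. lattice_merit \<alpha> \<gamma> N l (z(l := c))) [1..<N]"
  have "set (take ?t ?xs) \<subseteq> set ?xs" by (rule set_take_subset)
  moreover have "set ?xs = {1..N - 1}" by auto
  ultimately show "cbc_candidates \<alpha> \<gamma> \<tau> N l z \<subseteq> {1..N - 1}"
    unfolding cbc_candidates_def by simp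
  have "distinct (take ?t ?xs)" by simp
  hence "card (set (take ?t ?xs)) = min (N - 1) ?t" by (simp add: distinct_card)
  thus "card (cbc_candidates \<alpha> \<gamma> \<tau> N l z) = ?t"
    unfolding cbc_candidates_def using length_cbc_candidates_le(2)[OF assms] by simp
qed

text \<open>This unrolls the last draw. As every prefix admits equally many candidates, uniform
  choice among all vectors agrees with successive uniform draws, and counts can be made one
  component at a time.\<close>

lemma cbc_vectors_Suc:
  assumes N: "prime N" and \<tau>: "0 < \<tau>" "\<tau> < 1" and s: "s \<ge> 1"
  shows "bij_betw (\<lambda>(z, c). z(Suc s := c))
    (SIGMA z:cbc_vectors \<alpha> \<gamma> \<tau> s N. cbc_candidates \<alpha> \<gamma> \<tau> N (Suc s) z) (cbc_vectors \<alpha> \<gamma> \<tau> (Suc s) N)"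
proof (rule bij_betwI[of _ _ _ "\<lambda>z. (restrict z {1..s}, z (Suc s))"])
  show "(\<lambda>(z, c). z(Suc s := c)) \<in> (SIGMA z:cbc_vectors \<alpha> \<gamma> \<tau> s N. cbc_candidates \<alpha> \<gamma> \<tau> N (Suc s) z)
      \<rightarrow> cbc_vectors \<alpha> \<gamma> \<tau> (Suc s) N"
  proof safe
    fix z c assume z: "z \<in> cbc_vectors \<alpha> \<gamma> \<tau> s N" and c: "c \<in> cbc_candidates \<alpha> \<gamma> \<tau> N (Suc s) z"
    have zP: "z \<in> {1..s} \<rightarrow>\<^sub>E {1..N - 1}" using z by (simp add: cbc_vectors_def)
    have r: "restrict (z(Suc s := c)) {1..l - 1} = restrict z {1..l - 1}" if "l \<le> Suc s" for l
      using that by (auto simp: fun_eq_iff restrict_def)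
    have r': "restrict z {1..s} = z" using zP by (rule PiE_restrict)
    show "z(Suc s := c) \<in> cbc_vectors \<alpha> \<gamma> \<tau> (Suc s) N"
      unfolding cbc_vectors_def
    proof (intro CollectI conjI ballI)
      show "z(Suc s := c) \<in> {1..Suc s} \<rightarrow>\<^sub>E {1..N - 1}"
      proof -
        have "c \<in> {1..N - 1}" using c cbc_candidates(1)[OF N \<tau>] by blast
        thus ?thesis using zP by (auto simp: PiE_iff extensional_def le_Suc_eq)
      qed
      show "(z(Suc s := c)) 1 = 1" using z s by (auto simp: cbc_vectors_def)
      fix l assume l: "l \<in> {2..Suc s}"
      show "(z(Suc s := c)) l \<in> cbc_candidates \<alpha> \<gamma> \<tau> N l (restrict (z(Suc s := c)) {1..l - 1})"
      proof (cases "l = Suc s")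
        case True
        thus ?thesis using c r[of l] r' by simp
      next
        case False
        hence "l \<in> {2..s}" using l by auto
        thus ?thesis using z r[of l] False unfolding cbc_vectors_def by auto
      qed
    qed
  qed
  show "(\<lambda>z. (restrict z {1..s}, z (Suc s))) \<in> cbc_vectors \<alpha> \<gamma> \<tau> (Suc s) N
      \<rightarrow> (SIGMA z:cbc_vectors \<alpha> \<gamma> \<tau> s N. cbc_candidates \<alpha> \<gamma> \<tau> N (Suc s) z)"
  proof (intro funcsetI SigmaI)
    fix z assume z: "z \<in> cbc_vectors \<alpha> \<gamma> \<tau> (Suc s) N"
    have r: "restrict (restrict z {1..s}) {1..l - 1} = restrict z {1..l - 1}" if "l \<le> Suc s" for l
      using that by (auto simp: fun_eq_iff restrict_def)
    show "restrict z {1..s} \<in> cbc_vectors \<alpha> \<gamma> \<tau> s N"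
      unfolding cbc_vectors_def
    proof (intro CollectI conjI ballI)
      show "restrict z {1..s} \<in> {1..s} \<rightarrow>\<^sub>E {1..N - 1}"
        using z by (auto simp: cbc_vectors_def PiE_iff)
      show "restrict z {1..s} 1 = 1" using z s by (auto simp: cbc_vectors_def)
      fix l assume l: "l \<in> {2..s}"
      hence "z l \<in> cbc_candidates \<alpha> \<gamma> \<tau> N l (restrict z {1..l - 1})"
        using z by (auto simp: cbc_vectors_def)
      thus "restrict z {1..s} l \<in> cbc_candidates \<alpha> \<gamma> \<tau> N l (restrict (restrict z {1..s}) {1..l - 1})"
        using l r[of l] by simp
    qed
    show "z (Suc s) \<in> cbc_candidates \<alpha> \<gamma> \<tau> N (Suc s) (restrict z {1..s})"
      using z s unfolding cbc_vectors_def by (auto dest!: bspec[of _ _ "Suc s"])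
  qed
qed (auto simp: fun_eq_iff restrict_def cbc_vectors_def PiE_iff extensional_def)

lemma finite_cbc_vectors [simp]: "finite (cbc_vectors \<alpha> \<gamma> \<tau> s N)"
  by (rule finite_subset[of _ "{1..s} \<rightarrow>\<^sub>E {1..N - 1}"]) (auto simp: cbc_vectors_def intro: finite_PiE)

lemma cbc_vectors_1:
  assumes "prime N"
  shows "cbc_vectors \<alpha> \<gamma> \<tau> 1 N = {\<lambda>j\<in>{1..1}. 1}"
  using prime_gt_1_nat[OF assms] by (auto simp: cbc_vectors_def PiE_iff extensional_def fun_eq_iff)

lemma card_cbc_vectors_Suc:
  assumes "prime N" "0 < \<tau>" "\<tau> < 1" "s \<ge> 1"
  shows "card (cbc_vectors \<alpha> \<gamma> \<tau> (Suc s) N) = card (cbc_vectors \<alpha> \<gamma> \<tau> s N) * nat \<lceil>\<tau> * (real N - 1)\<rceil>"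
  using bij_betw_same_card[OF cbc_vectors_Suc[OF assms, of \<alpha> \<gamma>]]
  by (simp add: card_SigmaI cbc_candidates[OF assms(1-3)] finite_subset[OF cbc_candidates(1)[OF assms(1-3)]])

lemma card_cbc_vectors_pos:
  assumes "prime N" "0 < \<tau>" "\<tau> < 1" "s \<ge> 1"
  shows "card (cbc_vectors \<alpha> \<gamma> \<tau> s N) > 0"
  using assms(4)
proof (induction s rule: dec_induct)
  case base
  then show ?case using cbc_vectors_1[OF assms(1)] by simp
next
  case (step s)
  thus ?case using length_cbc_candidates_le(3)[OF assms(1-3)]
    unfolding card_cbc_vectors_Suc[OF assms(1-3) step.hyps(1)] by (intro mult_pos_pos) linarith+
qed

text \<open>At the last component of \<open>h\<close> that is not divisible by \<open>N\<close>, at most one candidate solves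
  the congruence; all later components do not matter.\<close>

lemma card_cbc_vectors_dual_lattice_le:
  assumes N: "prime N" and \<tau>: "0 < \<tau>" "\<tau> < 1" and "s \<ge> 1"
    and "j \<in> {1..s}" "\<not> int N dvd h j"
  shows "nat \<lceil>\<tau> * (real N - 1)\<rceil> * card {z\<in>cbc_vectors \<alpha> \<gamma> \<tau> s N. int N dvd (\<Sum>j=1..s. h j * int (z j))}
    \<le> card (cbc_vectors \<alpha> \<gamma> \<tau> s N)"
  using assms(4-)
proof (induction s arbitrary: j rule: dec_induct)
  case base
  \<comment> \<open>The only vector has z 1 = 1, so the sum is h 1, which N does not divide.\<close>
  hence "{z\<in>cbc_vectors \<alpha> \<gamma> \<tau> 1 N. int N dvd (\<Sum>j=1..1. h j * int (z j))} = {}"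
    unfolding cbc_vectors_1[OF N] by auto
  thus ?case by (simp only: card.empty mult_0_right zero_le)
next
  case (step s)
  define T where "T = nat \<lceil>\<tau> * (real N - 1)\<rceil>"
  define V where "V = cbc_vectors \<alpha> \<gamma> \<tau> s N"
  define K where "K = (\<lambda>z. cbc_candidates \<alpha> \<gamma> \<tau> N (Suc s) z)"
  define S where "S z = (\<Sum>j=1..s. h j * int (z j))" for z :: "nat \<Rightarrow> nat"
  have finK: "finite (K z)" and cardK: "card (K z) = T" for z
    unfolding K_def T_def
    by (rule finite_subset[OF cbc_candidates(1)[OF N \<tau>]], simp) (rule cbc_candidates(2)[OF N \<tau>])
  have S: "(\<Sum>j=1..Suc s. h j * int ((z(Suc s := c)) j)) = S z + h (Suc s) * int c" for z c
  proof -
    have "(\<Sum>j=1..s. h j * int ((z(Suc s := c)) j)) = S z"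
      unfolding S_def by (intro sum.cong) auto
    thus ?thesis by simp
  qed
  have "bij_betw (\<lambda>(z, c). z(Suc s := c)) (SIGMA z:V. {c\<in>K z. int N dvd S z + h (Suc s) * int c})
    {z\<in>cbc_vectors \<alpha> \<gamma> \<tau> (Suc s) N. int N dvd (\<Sum>j=1..Suc s. h j * int (z j))}"
    (is "bij_betw _ _ ?B")
  proof (rule bij_betw_subset[OF cbc_vectors_Suc[OF N \<tau> step.hyps(1), of \<alpha> \<gamma>]])
    show "(SIGMA z:V. {c\<in>K z. int N dvd S z + h (Suc s) * int c})
      \<subseteq> (SIGMA z:cbc_vectors \<alpha> \<gamma> \<tau> s N. cbc_candidates \<alpha> \<gamma> \<tau> N (Suc s) z)"
      by (auto simp: V_def K_def)
    have "cbc_vectors \<alpha> \<gamma> \<tau> (Suc s) N = (\<lambda>(z, c). z(Suc s := c)) ` (SIGMA z:V. K z)"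
      using cbc_vectors_Suc[OF N \<tau> step.hyps(1), of \<alpha> \<gamma>] unfolding V_def K_def bij_betw_def by simp
    thus "(\<lambda>(z, c). z(Suc s := c)) ` (SIGMA z:V. {c\<in>K z. int N dvd S z + h (Suc s) * int c}) = ?B"
      using S by (auto simp del: sum.cl_ivl_Suc)
  qed
  hence "card ?B = card (SIGMA z:V. {c\<in>K z. int N dvd S z + h (Suc s) * int c})"
    by (rule bij_betw_same_card[symmetric])
  also have "\<dots> = (\<Sum>z\<in>V. card {c\<in>K z. int N dvd S z + h (Suc s) * int c})"
    using finK by (intro card_SigmaI) (auto simp: V_def)
  finally have card: "card ?B = \<dots>" .
  have V': "card (cbc_vectors \<alpha> \<gamma> \<tau> (Suc s) N) = card V * T"
    unfolding V_def T_def by (rule card_cbc_vectors_Suc[OF N \<tau> step.hyps(1)])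
  have "T * card ?B \<le> card V * T"
  proof (cases "int N dvd h (Suc s)")
    case True
    hence "j \<in> {1..s}" using step.prems by (cases "j = Suc s") auto
    hence IH: "T * card {z\<in>V. int N dvd S z} \<le> card V"
      using step.IH[of j] step.prems unfolding T_def V_def S_def by auto
    \<comment> \<open>The last component has no influence modulo N, so either all extensions of z
      solve the congruence or none does.\<close>
    have "card {c\<in>K z. int N dvd S z + h (Suc s) * int c} = (if int N dvd S z then T else 0)" for z
      using True cardK[of z] by (simp add: dvd_add_left_iff)
    hence "card ?B = (\<Sum>z\<in>V. if int N dvd S z then T else 0)" using card by simp
    also have "\<dots> = T * card {z\<in>V. int N dvd S z}"
      by (simp add: sum.If_cases V_def Int_def)
    finally have "T * card ?B = T * (T * card {z\<in>V. int N dvd S z})" by simp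
    also have "\<dots> \<le> T * card V" using IH by (rule mult_le_mono2)
    finally show ?thesis by (simp add: mult.commute)
  next
    case False
    have "card {c\<in>K z. int N dvd S z + h (Suc s) * int c} \<le> 1" for z
    proof -
      have "c = c'" if "c \<in> K z" "c' \<in> K z"
        "int N dvd S z + h (Suc s) * int c" "int N dvd S z + h (Suc s) * int c'" for c c'
      proof -
        have "int N dvd (S z + h (Suc s) * int c) - (S z + h (Suc s) * int c')"
          using that by (intro dvd_diff)
        hence "int N dvd h (Suc s) * (int c - int c')" by (simp add: right_diff_distrib)
        hence "int N dvd int c - int c'" using False N by (auto simp: prime_dvd_mult_iff)
        moreover have "c \<in> {1..N - 1}" "c' \<in> {1..N - 1}"
          using that(1,2) cbc_candidates(1)[OF N \<tau>] unfolding K_def by blast+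
        hence "\<bar>int c - int c'\<bar> < int N" by auto
        ultimately have "int c - int c' = 0"
          using zdvd_not_zless[of "\<bar>int c - int c'\<bar>" "int N"] by (cases "int c - int c' = 0") auto
        thus ?thesis by simp
      qed
      thus ?thesis unfolding One_nat_def using finK by (subst card_le_Suc0_iff_eq) auto
    qed
    hence "card ?B \<le> (\<Sum>z\<in>V. 1)" unfolding card by (intro sum_mono)
    thus ?thesis by simp
  qed
  thus ?case unfolding V' T_def .
qed

subsection \<open>Integration error of tent-transformed lattice rules\<close>

text \<open>The sum is the real part of a geometric sum of an N-th root of unity, which vanishes
  unless the root is 1.\<close>

lemma sum_cos_multiples:
  assumes "N > 0"
  shows "(\<Sum>n<N. cos (2 * pi * real n * real_of_int m / real N)) = (if int N dvd m then real N else 0)"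
proof (cases "int N dvd m")
  case True
  then obtain q where q: "m = int N * q" by (rule dvdE)
  have "cos (2 * pi * real n * real_of_int m / real N) = 1" for n
    using cos_int_2pin[of "int n * q"] assms by (simp add: q mult_ac)
  thus ?thesis using True by simp
next
  case False
  define w where "w = cis (2 * pi * real_of_int m / real N)"
  have wN: "w ^ N = 1"
  proof -
    have "w ^ N = cis (real N * (2 * pi * real_of_int m / real N))"
      unfolding w_def by (rule Complex.DeMoivre)
    also have "\<dots> = cis (2 * pi * real_of_int m)" using assms by simp
    also have "\<dots> = 1" by (rule cis_multiple_2pi) simp
    finally show ?thesis .
  qed
  have w1: "w \<noteq> 1"
  proof
    assume "w = 1"
    hence "cos (2 * pi * real_of_int m / real N) = 1" by (simp add: w_def complex_eq_iff)
    then obtain q :: int where "2 * pi * real_of_int m / real N = real_of_int q * 2 * pi"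
      by (auto simp: cos_one_2pi_int)
    hence "real_of_int m = real_of_int (q * int N)" using assms by (simp add: field_simps)
    hence "m = q * int N" by (simp only: of_int_eq_iff)
    thus False using False by simp
  qed
  have "(\<Sum>n<N. cos (2 * pi * real n * real_of_int m / real N)) = Re (\<Sum>n<N. w ^ n)"
    by (simp add: w_def Complex.DeMoivre mult_ac)
  also have "(\<Sum>n<N. w ^ n) = 0"
    using geometric_sum[OF w1, of N] by (simp add: wN)
  finally show ?thesis using False by simp
qed

lemma prod_cis: "(\<Prod>j\<in>A. cis (f j)) = cis (\<Sum>j\<in>A. f j)"
  by (induction A rule: infinite_finite_induct) (auto simp: cis_mult)

definition sign_vecs :: "nat \<Rightarrow> (nat \<Rightarrow> int) set" where
  "sign_vecs s = ({1..s} \<rightarrow>\<^sub>E {1, -1})"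

lemma finite_sign_vecs [simp]: "finite (sign_vecs s)"
  unfolding sign_vecs_def by (intro finite_PiE) auto

lemma card_sign_vecs: "card (sign_vecs s) = 2 ^ s"
  unfolding sign_vecs_def by (simp add: card_PiE numeral_2_eq_2)

text \<open>Writing each cosine as half the sum of two exponentials and multiplying out gives one
  exponential per choice of signs; real parts give the claim.\<close>

lemma prod_cos_eq_sum_sign_vecs:
  fixes \<theta> :: "nat \<Rightarrow> real"
  shows "(\<Prod>j=1..s. cos (\<theta> j)) = (\<Sum>\<sigma>\<in>sign_vecs s. cos (\<Sum>j=1..s. of_int (\<sigma> j) * \<theta> j)) / 2 ^ s"
proof -
  have c: "complex_of_real (cos t) = (\<Sum>e\<in>{1, -1::int}. cis (of_int e * t)) / 2" for t
    by (simp add: complex_eq_iff)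
  have "complex_of_real (\<Prod>j=1..s. cos (\<theta> j)) = (\<Prod>j=1..s. \<Sum>e\<in>{1, -1::int}. cis (of_int e * \<theta> j)) / 2 ^ s"
    by (simp add: c of_real_prod prod_dividef)
  also have "(\<Prod>j=1..s. \<Sum>e\<in>{1, -1::int}. cis (of_int e * \<theta> j))
      = (\<Sum>\<sigma>\<in>sign_vecs s. \<Prod>j=1..s. cis (of_int (\<sigma> j) * \<theta> j))"
    unfolding sign_vecs_def by (rule prod_sum_PiE) auto
  also have "\<dots> = (\<Sum>\<sigma>\<in>sign_vecs s. cis (\<Sum>j=1..s. of_int (\<sigma> j) * \<theta> j))"
    by (simp add: prod_cis)
  finally have "Re (complex_of_real (\<Prod>j=1..s. cos (\<theta> j)))
      = Re ((\<Sum>\<sigma>\<in>sign_vecs s. cis (\<Sum>j=1..s. of_int (\<sigma> j) * \<theta> j)) / 2 ^ s)" by simp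
  also have "\<dots> = Re (\<Sum>\<sigma>\<in>sign_vecs s. cis (\<Sum>j=1..s. of_int (\<sigma> j) * \<theta> j)) / 2 ^ s"
  proof -
    have "(2::complex) ^ s = complex_of_real (2 ^ s)" by simp
    thus ?thesis by (simp only: Re_divide_of_real)
  qed
  finally show ?thesis unfolding Re_complex_of_real by simp
qed

text \<open>As a function of t, cos(pi k t) is even and has period 2, so the branches 2x and 2 - 2x
  of the tent give the same value. The resulting function has period 1 in x, which removes the
  fractional part.\<close>

lemma cos_tent_frac: "cos (pi * real k * tent (frac y)) = cos (2 * pi * real k * y)"
proof -
  have 1: "cos (2 * pi * real k * frac y) = cos (2 * pi * real k * y)"
  proof -
    have "2 * pi * real k * frac y = 2 * pi * real k * y - 2 * pi * of_int (int k * \<lfloor>y\<rfloor>)"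
      by (simp add: frac_def algebra_simps)
    thus ?thesis using cos_int_2pin[of "int k * \<lfloor>y\<rfloor>"] sin_int_2pin[of "int k * \<lfloor>y\<rfloor>"]
      by (simp add: cos_diff)
  qed
  show ?thesis
  proof (cases "frac y \<le> 1 / 2")
    case True
    hence "tent (frac y) = 2 * frac y" by (simp add: tent_def)
    thus ?thesis using 1 by (simp add: mult_ac)
  next
    case False
    hence "tent (frac y) = 2 - 2 * frac y" by (simp add: tent_def)
    hence "pi * real k * tent (frac y) = 2 * pi * of_int (int k) - 2 * pi * real k * frac y"
      by (simp only: right_diff_distrib of_int_of_nat_eq)
    thus ?thesis using 1 cos_int_2pin[of "int k"] sin_int_2pin[of "int k"]
      by (simp add: cos_diff)
  qed
qed

section \<open>Tent-transformed lattice rules applied to cosine series\<close>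

definition tent_point :: "nat \<Rightarrow> nat \<Rightarrow> (nat \<Rightarrow> nat) \<Rightarrow> nat \<Rightarrow> nat \<Rightarrow> real" where
  "tent_point s N z n = (\<lambda>j\<in>{1..s}. tent (frac (real n * real (z j) / real N)))"

lemma tent_lattice_points_eq: "tent_lattice_points s N z = image_mset (tent_point s N z) (mset_set {..<N})"
  unfolding tent_lattice_points_def lattice_points_def multiset.map_comp
  by (intro image_mset_cong) (auto simp: tent_point_def)

lemma multiset_average_tent_lattice_points:
  "multiset_average f (tent_lattice_points s N z) = (\<Sum>n<N. f (tent_point s N z n)) / real N"
  unfolding multiset_average_def tent_lattice_points_eq multiset.map_comp
  by (simp add: sum_unfold_sum_mset o_def)

lemma tent_point_in_cube: "tent_point s N z n \<in> cube s"
proof -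
  have "tent x \<in> {0..1}" if "x \<ge> 0" "x < 1" for x
    using that by (auto simp: tent_def abs_if)
  thus ?thesis by (auto simp: tent_point_def cube_def frac_lt_1)
qed

definition basis_average :: "nat \<Rightarrow> nat \<Rightarrow> (nat \<Rightarrow> nat) \<Rightarrow> (nat \<Rightarrow> nat) \<Rightarrow> real" where
  "basis_average s N z k = (\<Sum>n<N. cosine_basis s k (tent_point s N z n)) / real N"

text \<open>Each choice of signs contributes a character sum over the lattice, which is N or 0
  according to the dual lattice condition. The result is nonnegative, so no cancellation is lost
  later by taking absolute values of the averages.\<close>

lemma basis_average_eq:
  assumes "N > 0"
  shows "basis_average s N z k = (\<Prod>j=1..s. sqrt (2 - of_bool (k j = 0))) *
    real (card {\<sigma>\<in>sign_vecs s. int N dvd (\<Sum>j=1..s. (\<sigma> j * int (k j)) * int (z j))}) / 2 ^ s"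
proof -
  define P where "P = (\<Prod>j=1..s. sqrt (2 - of_bool (k j = 0)))"
  define m where "m \<sigma> = (\<Sum>j=1..s. (\<sigma> j * int (k j)) * int (z j))" for \<sigma>
  have b: "cosine_basis s k (tent_point s N z n)
      = P * ((\<Sum>\<sigma>\<in>sign_vecs s. cos (2 * pi * real n * real_of_int (m \<sigma>) / real N)) / 2 ^ s)" for n
  proof -
    have e: "(\<Sum>j=1..s. of_int (\<sigma> j) * (2 * pi * real (k j) * (real n * real (z j) / real N)))
        = 2 * pi * real n * real_of_int (m \<sigma>) / real N" for \<sigma> :: "nat \<Rightarrow> int"
      unfolding m_def of_int_sum sum_distrib_left sum_divide_distrib
      by (intro sum.cong) (auto simp: field_simps)
    have "cosine_basis s k (tent_point s N z n)
        = P * (\<Prod>j=1..s. cos (pi * real (k j) * tent (frac (real n * real (z j) / real N))))"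
      unfolding cosine_basis_def P_def prod.distrib[symmetric]
      by (intro prod.cong) (auto simp: tent_point_def)
    also have "(\<Prod>j=1..s. cos (pi * real (k j) * tent (frac (real n * real (z j) / real N))))
        = (\<Sum>\<sigma>\<in>sign_vecs s. cos (\<Sum>j=1..s. of_int (\<sigma> j) * (2 * pi * real (k j) * (real n * real (z j) / real N)))) / 2 ^ s"
      unfolding cos_tent_frac by (rule prod_cos_eq_sum_sign_vecs)
    finally show ?thesis unfolding e .
  qed
  have "basis_average s N z k
      = P / 2 ^ s / real N * (\<Sum>n<N. \<Sum>\<sigma>\<in>sign_vecs s. cos (2 * pi * real n * real_of_int (m \<sigma>) / real N))"
    unfolding basis_average_def b by (simp add: sum_distrib_left sum_divide_distrib)
  also have "(\<Sum>n<N. \<Sum>\<sigma>\<in>sign_vecs s. cos (2 * pi * real n * real_of_int (m \<sigma>) / real N))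
      = (\<Sum>\<sigma>\<in>sign_vecs s. \<Sum>n<N. cos (2 * pi * real n * real_of_int (m \<sigma>) / real N))"
    by (rule sum.swap)
  also have "\<dots> = (\<Sum>\<sigma>\<in>sign_vecs s. if int N dvd m \<sigma> then real N else 0)"
    using sum_cos_multiples[OF assms] by simp
  also have "\<dots> = real N * real (card {\<sigma>\<in>sign_vecs s. int N dvd m \<sigma>})"
    by (simp add: sum.If_cases Int_def)
  finally show ?thesis using assms unfolding P_def m_def by simp
qed

lemma basis_average_nonneg: "N > 0 \<Longrightarrow> basis_average s N z k \<ge> 0"
  unfolding basis_average_eq
  by (intro mult_nonneg_nonneg divide_nonneg_nonneg prod_nonneg ballI real_sqrt_ge_zero) (auto simp: of_bool_def)

lemma cosine_basis_zero: "cosine_basis s (\<lambda>j\<in>{1..s}. 0) x = 1"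
  unfolding cosine_basis_def by (intro prod.neutral) auto

text \<open>The transformed points stay in the cube, where the cosine series converges absolutely,
  so the rule acts on it term by term. The index 0 reproduces the integral exactly and the remaining
  terms form the error.\<close>

lemma tent_lattice_error_le:
  assumes N: "N > 0" and f: "f \<in> cosine_space \<alpha> \<gamma> s"
  shows "(\<lambda>k. \<bar>cosine_coeff s f k\<bar> * basis_average s N z k) summable_on (nat_vecs s - {\<lambda>j\<in>{1..s}. 0})"
    and "\<bar>multiset_average f (tent_lattice_points s N z) - cube_integral s f\<bar>
      \<le> (\<Sum>\<^sub>\<infinity>k\<in>nat_vecs s - {\<lambda>j\<in>{1..s}. 0}. \<bar>cosine_coeff s f k\<bar> * basis_average s N z k)"
proof -
  let ?x = "tent_point s N z"
  let ?o = "(\<lambda>j\<in>{1..s}. 0) :: nat \<Rightarrow> nat"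
  let ?g = "\<lambda>k. cosine_coeff s f k * basis_average s N z k"
  have abs_eq: "\<bar>?g k\<bar> = \<bar>cosine_coeff s f k\<bar> * basis_average s N z k" for k
    using basis_average_nonneg[OF N, of s z k] by (simp add: abs_mult)
  have hs: "((\<lambda>k. cosine_coeff s f k * cosine_basis s k (?x n)) has_sum f (?x n)) (nat_vecs s)"
    and ab: "(\<lambda>k. \<bar>cosine_coeff s f k * cosine_basis s k (?x n)\<bar>) summable_on nat_vecs s" for n
    using f tent_point_in_cube by (auto simp: cosine_space_def)
  have "((\<lambda>k. (\<Sum>n<N. cosine_coeff s f k * cosine_basis s k (?x n)) * (1 / real N))
      has_sum (\<Sum>n<N. f (?x n)) * (1 / real N)) (nat_vecs s)"
    using hs by (intro has_sum_cmult_left has_sum_finite_sum) auto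
  hence g: "(?g has_sum multiset_average f (tent_lattice_points s N z)) (nat_vecs s)"
    by (simp add: multiset_average_tent_lattice_points basis_average_def sum_distrib_left)
  have g0: "?g ?o = cube_integral s f"
    using N by (simp del: One_nat_def add: cosine_coeff_def basis_average_def cosine_basis_zero)
  have "(?g has_sum cube_integral s f) {?o}"
    by (rule has_sum_finiteI) (use g0 in auto)
  with g have d: "(?g has_sum (multiset_average f (tent_lattice_points s N z) - cube_integral s f)) (nat_vecs s - {?o})"
    by (rule has_sum_Diff) (auto simp: nat_vecs_def)
  have "(\<lambda>k. (\<Sum>n<N. \<bar>cosine_coeff s f k * cosine_basis s k (?x n)\<bar>) * (1 / real N)) summable_on nat_vecs s"
  proof (rule summable_on_cmult_left, rule has_sum_imp_summable, rule has_sum_finite_sum)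
    show "((\<lambda>k. \<bar>cosine_coeff s f k * cosine_basis s k (?x n)\<bar>) has_sum
      (\<Sum>\<^sub>\<infinity>k\<in>nat_vecs s. \<bar>cosine_coeff s f k * cosine_basis s k (?x n)\<bar>)) (nat_vecs s)" for n
      using ab by simp
  qed simp
  hence "(\<lambda>k. \<bar>?g k\<bar>) summable_on nat_vecs s"
  proof (rule summable_on_comparison_test)
    fix k
    have "\<bar>?g k\<bar> = \<bar>\<Sum>n<N. cosine_coeff s f k * cosine_basis s k (?x n)\<bar> * (1 / real N)"
      by (simp add: basis_average_def sum_distrib_left[symmetric] abs_mult)
    also have "\<dots> \<le> (\<Sum>n<N. \<bar>cosine_coeff s f k * cosine_basis s k (?x n)\<bar>) * (1 / real N)"
      by (intro mult_right_mono sum_abs) auto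
    finally show "\<bar>?g k\<bar> \<le> \<dots>" .
  qed auto
  hence abs: "(\<lambda>k. \<bar>?g k\<bar>) summable_on (nat_vecs s - {?o})"
    by (rule summable_on_subset_banach) auto
  thus "(\<lambda>k. \<bar>cosine_coeff s f k\<bar> * basis_average s N z k) summable_on (nat_vecs s - {?o})"
    by (simp only: abs_eq)
  have "((\<lambda>k. norm (?g k)) has_sum (\<Sum>\<^sub>\<infinity>k\<in>nat_vecs s - {?o}. \<bar>?g k\<bar>)) (nat_vecs s - {?o})"
    using abs by simp
  from norm_has_sum_bound[OF this d]
  show "\<bar>multiset_average f (tent_lattice_points s N z) - cube_integral s f\<bar>
      \<le> (\<Sum>\<^sub>\<infinity>k\<in>nat_vecs s - {?o}. \<bar>cosine_coeff s f k\<bar> * basis_average s N z k)"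
    by (simp only: abs_eq real_norm_def)
qed

subsection \<open>Dual lattice probabilities\<close>

lemma admissible_primesD:
  assumes "N \<in> admissible_primes M"
  shows "prime N" and "N > 0" and "real M / 2 \<le> real N - 1" and "M \<le> N\<^sup>2"
proof -
  show p: "prime N" using assms by (simp add: admissible_primes_def)
  thus "N > 0" by (rule prime_gt_0_nat)
  have "\<lceil>real M / 2\<rceil> < int N" using assms by (simp add: admissible_primes_def)
  thus M: "real M / 2 \<le> real N - 1" by linarith
  have "2 * N \<le> N * N" using prime_ge_2_nat[OF p] by (intro mult_right_mono) auto
  moreover have "M \<le> 2 * N" using M by linarith
  ultimately show "M \<le> N\<^sup>2" unfolding power2_eq_square by (rule order_trans[rotated])
qed

text \<open>The product of the distinct primes dividing m is at most |m|, and each of them satisfies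
  M \<le> N^2, hence ln M \<le> 2 ln N.\<close>

lemma card_admissible_primes_dvd_le:
  fixes m :: int
  assumes M: "M > 0" and m: "m \<noteq> 0"
  shows "real (card {N\<in>admissible_primes M. int N dvd m}) * ln (real M) \<le> 2 * ln (real_of_int \<bar>m\<bar>)"
proof -
  define Q where "Q = {N\<in>admissible_primes M. int N dvd m}"
  have Qp: "prime N" "N > 0" "M \<le> N\<^sup>2" if "N \<in> Q" for N
    using that admissible_primesD[of N M] by (auto simp: Q_def)
  have fQ: "finite Q" by (simp add: Q_def)
  have "\<Prod>Q dvd nat \<bar>m\<bar>"
    by (intro prod_primes_dvd) (auto simp: Q_def admissible_primesD nat_dvd_iff)
  hence le: "\<Prod>Q \<le> nat \<bar>m\<bar>" using m by (intro dvd_imp_le) auto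
  have "real (card Q) * ln (real M) = (\<Sum>N\<in>Q. ln (real M))" by simp
  also have "\<dots> \<le> (\<Sum>N\<in>Q. 2 * ln (real N))"
  proof (intro sum_mono)
    fix N assume N: "N \<in> Q"
    have "ln (real M) \<le> ln (real (N\<^sup>2))" using M Qp[OF N] by (subst ln_le_cancel_iff) auto
    also have "\<dots> = 2 * ln (real N)" using Qp[OF N] by (simp add: ln_realpow)
    finally show "ln (real M) \<le> 2 * ln (real N)" .
  qed
  also have "\<dots> = 2 * ln (real (\<Prod>Q))"
    using Qp fQ by (simp add: ln_prod sum_distrib_left)
  also have "\<dots> \<le> 2 * ln (real_of_int \<bar>m\<bar>)"
  proof -
    have "0 < \<Prod>Q" using Qp by (intro prod_pos) auto
    moreover have "real (\<Prod>Q) \<le> real_of_int \<bar>m\<bar>"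
      using le m by (metis abs_ge_zero int_nat_eq nat_le_iff of_int_le_iff of_int_of_nat_eq of_nat_le_iff)
    ultimately show ?thesis by (simp del: of_nat_prod)
  qed
  finally show ?thesis unfolding Q_def .
qed

section \<open>The probability of lying in the random dual lattice\<close>

definition dual_probability ::
    "real \<Rightarrow> (nat \<Rightarrow> real) \<Rightarrow> real \<Rightarrow> nat \<Rightarrow> nat \<Rightarrow> (nat \<Rightarrow> int) \<Rightarrow> real" where
  "dual_probability \<alpha> \<gamma> \<tau> s M h = 1 / real (card (admissible_primes M)) * (\<Sum>N\<in>admissible_primes M.
     1 / real (card (cbc_vectors \<alpha> \<gamma> \<tau> s N)) * (\<Sum>z\<in>cbc_vectors \<alpha> \<gamma> \<tau> s N.
       of_bool (int N dvd (\<Sum>j=1..s. h j * int (z j)))))"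

text \<open>For primes not dividing h j the conditional probability is at most 1 over the number of
  candidates, hence at most 2 / (\<tau> M). For the others the trivial bound 1 is used, and their
  share among the admissible primes is small.\<close>

lemma dual_probability_le:
  assumes M: "M \<ge> 2" and ne: "admissible_primes M \<noteq> {}" and s: "s \<ge> 1"
    and \<tau>: "0 < \<tau>" "\<tau> < 1" and h: "j \<in> {1..s}" "h j \<noteq> 0"
    and c: "c > 0" "real M \<le> c * real (card (admissible_primes M)) * ln (real M)"
  shows "dual_probability \<alpha> \<gamma> \<tau> s M h \<le> (2 / \<tau> + 2 * c * ln (real_of_int \<bar>h j\<bar>)) / real M"
proof -
  define P where "P = admissible_primes M"
  define q where "q = card {N\<in>P. int N dvd h j}"
  have P: "real (card P) > 0" using ne by (simp add: P_def card_gt_0_iff)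
  have "1 / real (card (cbc_vectors \<alpha> \<gamma> \<tau> s N)) * (\<Sum>z\<in>cbc_vectors \<alpha> \<gamma> \<tau> s N. of_bool (int N dvd (\<Sum>j=1..s. h j * int (z j))))
      \<le> 2 / (\<tau> * real M) + of_bool (int N dvd h j)" if N: "N \<in> P" for N
  proof -
    define Z where "Z = cbc_vectors \<alpha> \<gamma> \<tau> s N"
    define B where "B = {z\<in>Z. int N dvd (\<Sum>j=1..s. h j * int (z j))}"
    have pN: "prime N" and N2: "real M / 2 \<le> real N - 1"
      using admissible_primesD[of N M] N by (auto simp: P_def)
    have Z: "real (card Z) > 0"
      using card_cbc_vectors_pos[OF pN \<tau> s] by (simp add: Z_def)
    have fZ: "finite Z" by (simp add: Z_def)
    have B: "(\<Sum>z\<in>Z. of_bool (int N dvd (\<Sum>j=1..s. h j * int (z j)))) = real (card B)"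
      using fZ by (simp add: B_def Int_def)
    have "real (card B) / real (card Z) \<le> 2 / (\<tau> * real M) + of_bool (int N dvd h j)"
    proof (cases "int N dvd h j")
      case True
      have "card B \<le> card Z" using fZ by (intro card_mono) (auto simp: B_def)
      hence "real (card B) / real (card Z) \<le> 1" using Z by simp
      moreover have "2 / (\<tau> * real M) \<ge> 0" using \<tau> by simp
      ultimately have "real (card B) / real (card Z) \<le> 2 / (\<tau> * real M) + 1" by linarith
      thus ?thesis using True by simp
    next
      case False
      have "\<tau> * real M / 2 \<le> \<tau> * (real N - 1)" using N2 \<tau> by simp
      also have "\<dots> \<le> real (nat \<lceil>\<tau> * (real N - 1)\<rceil>)" by linarith
      finally have "\<tau> * real M / 2 * real (card B) \<le> real (nat \<lceil>\<tau> * (real N - 1)\<rceil>) * real (card B)"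
        by (intro mult_right_mono) auto
      also have "\<dots> \<le> real (card Z)"
        using card_cbc_vectors_dual_lattice_le[where h = h and j = j and \<alpha> = \<alpha> and \<gamma> = \<gamma>,
            OF pN \<tau> s h(1) False]
        unfolding B_def Z_def of_nat_mult[symmetric] of_nat_le_iff .
      finally have "real (card B) / real (card Z) \<le> 2 / (\<tau> * real M)"
        using Z M \<tau> by (simp add: field_simps)
      thus ?thesis using False by simp
    qed
    thus ?thesis unfolding Z_def[symmetric] B by simp
  qed
  hence "dual_probability \<alpha> \<gamma> \<tau> s M h
      \<le> 1 / real (card P) * (\<Sum>N\<in>P. 2 / (\<tau> * real M) + of_bool (int N dvd h j))"
    unfolding dual_probability_def P_def by (intro mult_left_mono sum_mono) auto
  also have "(\<Sum>N\<in>P. 2 / (\<tau> * real M) + of_bool (int N dvd h j)) = real (card P) * (2 / (\<tau> * real M)) + real q"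
    by (simp add: sum.distrib q_def P_def Int_def)
  also have "1 / real (card P) * \<dots> = 2 / (\<tau> * real M) + real q / real (card P)"
    using P by (simp add: field_simps)
  \<comment> \<open>The factor ln M cancels: it divides the bound on the number of prime divisors
    and multiplies the bound on the reciprocal of the number of primes.\<close>
  also have "real q / real (card P) \<le> 2 * c * ln (real_of_int \<bar>h j\<bar>) / real M"
  proof -
    have "real q * real M \<le> real q * (c * real (card P) * ln (real M))"
      using c(2) unfolding P_def by (intro mult_left_mono) auto
    also have "\<dots> = c * real (card P) * (real q * ln (real M))" by simp
    also have "\<dots> \<le> c * real (card P) * (2 * ln (real_of_int \<bar>h j\<bar>))"
      using card_admissible_primes_dvd_le[of M "h j"] M h c unfolding q_def P_def
      by (intro mult_left_mono) auto
    finally show ?thesis using P M by (simp add: field_simps)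
  qed
  also have "2 / (\<tau> * real M) + 2 * c * ln (real_of_int \<bar>h j\<bar>) / real M
      = (2 / \<tau> + 2 * c * ln (real_of_int \<bar>h j\<bar>)) / real M"
    by (simp add: add_divide_distrib)
  finally show ?thesis by simp
qed

text \<open>A nonzero probability provides an actual N and z with h in the dual lattice. The
  constant 4 is 2 from the bound for fixed N times 2 from N - 1 \<ge> M/2.\<close>

lemma decay_le_if_dual_probability_nonzero:
  assumes M: "M \<ge> 2" and \<tau>: "0 < \<tau>" "\<tau> < 1" and lam: "1 / 2 < lam" "lam < \<alpha>"
    and \<gamma>: "\<And>j. j \<in> {1..s} \<Longrightarrow> \<gamma> j \<ge> 0"
    and h: "h \<in> int_vecs s" "j \<in> {1..s}" "h j \<noteq> 0"
    and nz: "dual_probability \<alpha> \<gamma> \<tau> s M h \<noteq> 0"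
  shows "decay \<alpha> \<gamma> s h powr (1 / lam) \<le> 4 * weight_zeta_sum \<alpha> \<gamma> s lam / ((1 - \<tau>) * real M)"
proof -
  define S where "S N = (\<Sum>z\<in>cbc_vectors \<alpha> \<gamma> \<tau> s N.
    of_bool (int N dvd (\<Sum>j=1..s. h j * int (z j))) :: real)" for N
  have "(\<Sum>N\<in>admissible_primes M. 1 / real (card (cbc_vectors \<alpha> \<gamma> \<tau> s N)) * S N) \<noteq> 0"
    using nz unfolding dual_probability_def S_def[symmetric] mult_eq_0_iff de_Morgan_disj by (rule conjunct2)
  then obtain N where N: "N \<in> admissible_primes M" and
    "1 / real (card (cbc_vectors \<alpha> \<gamma> \<tau> s N)) * S N \<noteq> 0"
    by (rule sum.not_neutral_contains_not_neutral)
  from this(2) have "S N \<noteq> 0" unfolding mult_eq_0_iff de_Morgan_disj by (rule conjunct2)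
  then obtain z where "z \<in> cbc_vectors \<alpha> \<gamma> \<tau> s N"
    "of_bool (int N dvd (\<Sum>j=1..s. h j * int (z j))) \<noteq> (0::real)"
    unfolding S_def by (rule sum.not_neutral_contains_not_neutral)
  hence z: "z \<in> cbc_vectors \<alpha> \<gamma> \<tau> s N" "int N dvd (\<Sum>j=1..s. h j * int (z j))" by simp_all
  have "h \<in> dual_lattice s N z" using h z by (simp add: dual_lattice_def cong_0_iff)
  from cbc_decay_le[OF admissible_primesD(1)[OF N] \<tau> lam \<gamma> z(1) this h(2,3)]
  have *: "(1 - \<tau>) * (real N - 1) * decay \<alpha> \<gamma> s h powr (1 / lam) \<le> 2 * weight_zeta_sum \<alpha> \<gamma> s lam" by simp
  have "(1 - \<tau>) * (real M / 2) * decay \<alpha> \<gamma> s h powr (1 / lam)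
      \<le> (1 - \<tau>) * (real N - 1) * decay \<alpha> \<gamma> s h powr (1 / lam)"
    using admissible_primesD(3)[OF N] \<tau> by (intro mult_right_mono mult_left_mono) auto
  thus ?thesis using * \<tau> M by (simp add: field_simps)
qed

lemma decay_factor_le_1:
  assumes "0 \<le> c" "c \<le> 1" "0 \<le> a"
  shows "decay_factor a c m \<le> 1"
proof (cases "m = 0")
  case False
  have "1 \<le> real_of_int \<bar>m\<bar> powr a" using False assms by (intro ge_one_powr_ge_zero) auto
  thus ?thesis using False assms by (simp add: decay_factor_def divide_le_eq)
qed (simp add: decay_factor_def)

lemma decay_le_component:
  assumes a: "0 \<le> a" and \<gamma>: "\<And>j. j \<in> {1..l} \<Longrightarrow> 0 \<le> \<gamma> j \<and> \<gamma> j \<le> 1"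
    and j: "j \<in> {1..l}" "h j \<noteq> 0"
  shows "decay a \<gamma> l h \<le> 1 / real_of_int \<bar>h j\<bar> powr a"
proof -
  have "decay a \<gamma> l h = decay_factor a (\<gamma> j) (h j) * (\<Prod>i\<in>{1..l} - {j}. decay_factor a (\<gamma> i) (h i))"
    unfolding decay_def using j by (intro prod.remove) auto
  also have "\<dots> \<le> decay_factor a (\<gamma> j) (h j) * 1"
    using a \<gamma> j by (intro mult_left_mono prod_le_1) (auto simp: decay_factor_nonneg decay_factor_le_1)
  also have "\<dots> \<le> 1 / real_of_int \<bar>h j\<bar> powr a"
    using \<gamma>[OF j(1)] j by (auto simp: decay_factor_def divide_right_mono)
  finally show ?thesis .
qed

text \<open>Since all weights are at most 1, the decay is at most |h j|^(-\<alpha>), so a logarithm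
  of the component is dominated by an arbitrarily small negative power of the decay.\<close>

lemma ln_component_le_decay_powr:
  assumes a: "1 / 2 < \<alpha>" and \<gamma>: "\<And>j. j \<in> {1..s} \<Longrightarrow> 0 \<le> \<gamma> j \<and> \<gamma> j \<le> 1"
    and h: "j \<in> {1..s}" "h j \<noteq> 0" and pos: "decay \<alpha> \<gamma> s h > 0" and e: "e > 0"
  shows "ln (real_of_int \<bar>h j\<bar>) \<le> 2 / e * decay \<alpha> \<gamma> s h powr (- e)"
    and "1 \<le> decay \<alpha> \<gamma> s h powr (- e)"
proof -
  define x where "x = real_of_int \<bar>h j\<bar>"
  define \<rho> where "\<rho> = decay \<alpha> \<gamma> s h"
  have x: "x \<ge> 1" using h unfolding x_def by simp
  have "\<rho> \<le> 1 / x powr \<alpha>"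
    unfolding \<rho>_def x_def using a by (intro decay_le_component \<gamma> h) auto
  also have "\<dots> = x powr (- \<alpha>)" by (simp add: powr_minus divide_inverse)
  finally have "(x powr (- \<alpha>)) powr (- e) \<le> \<rho> powr (- e)"
    using pos e by (intro powr_mono2') (auto simp: \<rho>_def)
  hence le: "x powr (\<alpha> * e) \<le> \<rho> powr (- e)" by (simp add: powr_powr)
  have "ln x \<le> x powr (\<alpha> * e) / (\<alpha> * e)" using x a e by (intro ln_powr_bound) auto
  also have "\<dots> \<le> \<rho> powr (- e) / (\<alpha> * e)" using le a e by (intro divide_right_mono) auto
  \<comment> \<open>Replacing \<alpha> by its lower bound 1/2 keeps the constant independent of
    \<alpha>.\<close>
  also have "\<dots> \<le> \<rho> powr (- e) / (1 / 2 * e)" using a e by (intro divide_left_mono) auto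
  finally show "ln (real_of_int \<bar>h j\<bar>) \<le> 2 / e * decay \<alpha> \<gamma> s h powr (- e)"
    unfolding x_def \<rho>_def by (simp add: mult.commute)
  have "1 \<le> x powr (\<alpha> * e)" using x a e by (intro ge_one_powr_ge_zero) auto
  thus "1 \<le> decay \<alpha> \<gamma> s h powr (- e)" using le unfolding \<rho>_def by simp
qed

text \<open>Exchanging sums shows that the mean is the normalising factor times the average over
  signs of the dual lattice probabilities.\<close>

lemma mean_basis_average_le:
  assumes "\<And>\<sigma>. \<sigma> \<in> sign_vecs s \<Longrightarrow> dual_probability \<alpha> \<gamma> \<tau> s M (\<lambda>j\<in>{1..s}. \<sigma> j * int (k j)) \<le> B"
  shows "1 / real (card (admissible_primes M)) * (\<Sum>N\<in>admissible_primes M.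
      1 / real (card (cbc_vectors \<alpha> \<gamma> \<tau> s N)) * (\<Sum>z\<in>cbc_vectors \<alpha> \<gamma> \<tau> s N. basis_average s N z k))
    \<le> (\<Prod>j=1..s. sqrt (2 - of_bool (k j = 0))) * B"
proof -
  define Q where "Q = (\<Prod>j=1..s. sqrt (2 - of_bool (k j = 0)))"
  have Q: "Q \<ge> 0" unfolding Q_def by (intro prod_nonneg) (auto simp: of_bool_def)
  have ba: "basis_average s N z k = Q / 2 ^ s * (\<Sum>\<sigma>\<in>sign_vecs s.
      of_bool (int N dvd (\<Sum>j=1..s. (\<lambda>j\<in>{1..s}. \<sigma> j * int (k j)) j * int (z j))))"
    if "N \<in> admissible_primes M" for N z
  proof -
    have "(\<Sum>j=1..s. (\<lambda>j\<in>{1..s}. \<sigma> j * int (k j)) j * int (z j)) = (\<Sum>j=1..s. (\<sigma> j * int (k j)) * int (z j))" for \<sigma>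
      by (intro sum.cong) auto
    thus ?thesis
      using basis_average_eq[OF admissible_primesD(2)[OF that], of s z k] by (simp add: Q_def Int_def)
  qed
  have "1 / real (card (admissible_primes M)) * (\<Sum>N\<in>admissible_primes M.
      1 / real (card (cbc_vectors \<alpha> \<gamma> \<tau> s N)) * (\<Sum>z\<in>cbc_vectors \<alpha> \<gamma> \<tau> s N. basis_average s N z k))
    = 1 / real (card (admissible_primes M)) * (\<Sum>N\<in>admissible_primes M.
      1 / real (card (cbc_vectors \<alpha> \<gamma> \<tau> s N)) * (\<Sum>z\<in>cbc_vectors \<alpha> \<gamma> \<tau> s N. Q / 2 ^ s * (\<Sum>\<sigma>\<in>sign_vecs s.
      of_bool (int N dvd (\<Sum>j=1..s. (\<lambda>j\<in>{1..s}. \<sigma> j * int (k j)) j * int (z j))))))"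
    using ba by (intro arg_cong2[of _ _ _ _ times] sum.cong refl) auto
  also have "\<dots> = (\<Sum>N\<in>admissible_primes M. \<Sum>z\<in>cbc_vectors \<alpha> \<gamma> \<tau> s N. \<Sum>\<sigma>\<in>sign_vecs s.
      1 / real (card (admissible_primes M)) * (1 / real (card (cbc_vectors \<alpha> \<gamma> \<tau> s N)) * (Q / 2 ^ s *
      of_bool (int N dvd (\<Sum>j=1..s. (\<lambda>j\<in>{1..s}. \<sigma> j * int (k j)) j * int (z j))))))"
    unfolding sum_distrib_left ..
  also have "\<dots> = (\<Sum>\<sigma>\<in>sign_vecs s. \<Sum>N\<in>admissible_primes M. \<Sum>z\<in>cbc_vectors \<alpha> \<gamma> \<tau> s N.
      1 / real (card (admissible_primes M)) * (1 / real (card (cbc_vectors \<alpha> \<gamma> \<tau> s N)) * (Q / 2 ^ s *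
      of_bool (int N dvd (\<Sum>j=1..s. (\<lambda>j\<in>{1..s}. \<sigma> j * int (k j)) j * int (z j))))))"
    by (subst sum.swap[where B = "sign_vecs s"], subst sum.swap[where B = "sign_vecs s"]) (rule refl)
  also have "\<dots> = (\<Sum>\<sigma>\<in>sign_vecs s. Q / 2 ^ s * dual_probability \<alpha> \<gamma> \<tau> s M (\<lambda>j\<in>{1..s}. \<sigma> j * int (k j)))"
    unfolding dual_probability_def sum_distrib_left by (intro sum.cong refl) (simp only: mult_ac)
  also have "\<dots> \<le> (\<Sum>\<sigma>\<in>sign_vecs s. Q / 2 ^ s * B)"
    using assms Q by (intro sum_mono mult_left_mono) auto
  also have "\<dots> = Q * B" by (simp add: card_sign_vecs)
  finally show ?thesis unfolding Q_def .
qed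

subsection \<open>The randomized error\<close>

text \<open>This prepares the Cauchy-Schwarz split. Weight and decay cancel unless the weight is 0,
  which happens only through a vanishing \<gamma> j with k j nonzero; then the coefficient is 0 by
  the definition of the space.\<close>

lemma cosine_coeff_eq_decay:
  assumes f: "f \<in> cosine_space \<alpha> \<gamma> s" and k: "k \<in> nat_vecs s"
  shows "\<bar>cosine_coeff s f k\<bar>
    = \<bar>korobov_weight \<alpha> \<gamma> s (\<lambda>j. int (k j)) * cosine_coeff s f k\<bar> * \<bar>decay \<alpha> \<gamma> s (\<lambda>j. int (k j))\<bar>"
proof (cases "korobov_weight \<alpha> \<gamma> s (\<lambda>j. int (k j)) = 0")
  case True
  then obtain j where "j \<in> {1..s}" "k j \<noteq> 0" "\<gamma> j = 0"
    unfolding korobov_weight_def by (auto simp: prod_zero_iff)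
  hence "cosine_coeff s f k = 0" using f k unfolding cosine_space_def by blast
  thus ?thesis by simp
next
  case False
  thus ?thesis by (simp add: abs_mult flip: inverse_korobov_weight)
qed

text \<open>The probability bound, with its logarithm absorbed, leaves \<rho>^(2 -
  2\<delta>/\<open>lam\<close>). This splits into a power 2\<open>lam\<close> - 2\<delta> - 1 > 0 of
  \<rho>^(1/\<open>lam\<close>), bounded through X, and one factor \<rho>^(1/\<open>lam\<close>),
  kept because it is summable over k.\<close>

lemma mean_basis_average_decay_le:
  fixes lam \<delta> \<tau> c :: real
  assumes M: "M \<ge> 2" and ne: "admissible_primes M \<noteq> {}" and s: "s \<ge> 1"
    and \<tau>: "0 < \<tau>" "\<tau> < 1" and lam: "1 / 2 < lam" "lam < \<alpha>" and \<delta>: "0 < \<delta>" "\<delta> < lam - 1 / 2"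
    and \<gamma>: "\<And>j. j \<in> {1..s} \<Longrightarrow> 0 \<le> \<gamma> j \<and> \<gamma> j \<le> 1"
    and c: "c > 0" "real M \<le> c * real (card (admissible_primes M)) * ln (real M)"
    and k: "k \<in> nat_vecs s - {\<lambda>j\<in>{1..s}. 0}"
  defines "E \<equiv> 1 / real (card (admissible_primes M)) * (\<Sum>N\<in>admissible_primes M.
      1 / real (card (cbc_vectors \<alpha> \<gamma> \<tau> s N)) * (\<Sum>z\<in>cbc_vectors \<alpha> \<gamma> \<tau> s N. basis_average s N z k))"
    and "\<rho> \<equiv> decay \<alpha> \<gamma> s (\<lambda>j. int (k j))"
    and "K \<equiv> 2 / \<tau> + 4 * c * lam / \<delta>"
    and "X \<equiv> 4 * weight_zeta_sum \<alpha> \<gamma> s lam / ((1 - \<tau>) * real M)"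
  shows "(\<rho> * E)\<^sup>2 \<le> (K / real M)\<^sup>2 * X powr (2 * lam - 2 * \<delta> - 1) * ((\<Prod>j=1..s. 2 - of_bool (k j = 0)) * \<rho> powr (1 / lam))"
proof -
  define Q where "Q = (\<Prod>j=1..s. sqrt (2 - of_bool (k j = 0)))"
  define e where "e = \<delta> / lam"
  have e: "e > 0" using \<delta> lam by (simp add: e_def)
  have Q0: "Q \<ge> 0" unfolding Q_def by (intro prod_nonneg) (auto simp: of_bool_def)
  have Q2: "Q\<^sup>2 = (\<Prod>j=1..s. 2 - of_bool (k j = 0))"
    unfolding Q_def prod_power_distrib by (intro prod.cong) (auto simp: of_bool_def)
  have \<gamma>0: "\<gamma> j \<ge> 0" if "j \<in> {1..s}" for j using \<gamma>[OF that] by simp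
  have \<rho>0: "\<rho> \<ge> 0" unfolding \<rho>_def by (intro decay_nonneg \<gamma>0)
  have E0: "E \<ge> 0" unfolding E_def
    by (intro mult_nonneg_nonneg sum_nonneg basis_average_nonneg) (auto simp: admissible_primesD)
  have K0: "K \<ge> 0" unfolding K_def using \<tau> c lam \<delta> by simp
  obtain j where j: "j \<in> {1..s}" "k j \<noteq> 0"
  proof -
    have "\<exists>j\<in>{1..s}. k j \<noteq> 0"
    proof (rule ccontr)
      assume "\<not> ?thesis"
      hence "k = (\<lambda>j\<in>{1..s}. 0)" using k by (auto simp: nat_vecs_def PiE_iff extensional_def fun_eq_iff)
      thus False using k by simp
    qed
    thus ?thesis using that by blast
  qed
  let ?h = "\<lambda>\<sigma>. (\<lambda>j\<in>{1..s}. \<sigma> j * int (k j)) :: nat \<Rightarrow> int"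
  have h: "\<bar>?h \<sigma> j\<bar> = int (k j)" "?h \<sigma> j \<noteq> 0" "?h \<sigma> \<in> int_vecs s" "decay \<alpha> \<gamma> s (?h \<sigma>) = \<rho>" if "\<sigma> \<in> sign_vecs s" for \<sigma>
  proof -
    have \<sigma>: "\<sigma> i = 1 \<or> \<sigma> i = -1" if "i \<in> {1..s}" for i
      using \<open>\<sigma> \<in> sign_vecs s\<close> that by (auto simp: sign_vecs_def PiE_iff)
    show "\<bar>?h \<sigma> j\<bar> = int (k j)" "?h \<sigma> j \<noteq> 0" using \<sigma>[OF j(1)] j by auto
    show "?h \<sigma> \<in> int_vecs s" by (auto simp: int_vecs_def)
    show "decay \<alpha> \<gamma> s (?h \<sigma>) = \<rho>" unfolding decay_def \<rho>_def
    proof (intro prod.cong refl)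
      fix i assume i: "i \<in> {1..s}"
      show "decay_factor \<alpha> (\<gamma> i) (?h \<sigma> i) = decay_factor \<alpha> (\<gamma> i) (int (k i))"
        using \<sigma>[OF i] i by (auto simp: decay_factor_def)
    qed
  qed
  define R where "R = (K / real M)\<^sup>2 * X powr (2 * lam - 2 * \<delta> - 1) * (Q\<^sup>2 * \<rho> powr (1 / lam))"
  have R0: "R \<ge> 0" unfolding R_def by simp
  have "(\<rho> * E)\<^sup>2 \<le> R"
  proof (cases "\<rho> > 0 \<and> \<rho> powr (1 / lam) \<le> X")
    case True
    have "dual_probability \<alpha> \<gamma> \<tau> s M (?h \<sigma>) \<le> K / real M * \<rho> powr (- e)" if \<sigma>: "\<sigma> \<in> sign_vecs s" for \<sigma>
    proof -
      have pos: "decay \<alpha> \<gamma> s (?h \<sigma>) > 0" using h(4)[OF \<sigma>] True by simp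
      have \<alpha>: "\<alpha> > 1 / 2" using lam by simp
      have 1: "ln (real_of_int \<bar>?h \<sigma> j\<bar>) \<le> 2 / e * \<rho> powr (- e)" "1 \<le> \<rho> powr (- e)"
        using ln_component_le_decay_powr[of \<alpha> s \<gamma> j "?h \<sigma>" e, OF \<alpha> \<gamma> j(1) h(2)[OF \<sigma>] pos e] h(4)[OF \<sigma>] by simp_all
      have "dual_probability \<alpha> \<gamma> \<tau> s M (?h \<sigma>) \<le> (2 / \<tau> + 2 * c * ln (real_of_int \<bar>?h \<sigma> j\<bar>)) / real M"
        by (rule dual_probability_le[where h = "?h \<sigma>" and j = j, OF M ne s \<tau> j(1) h(2)[OF \<sigma>] c])
      also have "\<dots> \<le> (2 / \<tau> * \<rho> powr (- e) + 2 * c * (2 / e * \<rho> powr (- e))) / real M"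
        using 1 c \<tau> mult_left_mono[OF 1(2), of "2 / \<tau>"] by (intro divide_right_mono add_mono mult_left_mono) auto
      also have "\<dots> = K / real M * \<rho> powr (- e)"
        unfolding K_def e_def by (simp add: algebra_simps add_divide_distrib)
      finally show ?thesis .
    qed
    hence "E \<le> Q * (K / real M * \<rho> powr (- e))"
      unfolding E_def Q_def by (rule mean_basis_average_le)
    hence "(\<rho> * E)\<^sup>2 \<le> (\<rho> * (Q * (K / real M * \<rho> powr (- e))))\<^sup>2"
      using \<rho>0 E0 by (intro power_mono mult_left_mono) auto
    also have "\<dots> = (K / real M)\<^sup>2 * (Q\<^sup>2 * (\<rho>\<^sup>2 * (\<rho> powr (- e))\<^sup>2))"
      by (simp add: power_mult_distrib power_divide mult_ac)
    also have "\<rho>\<^sup>2 * (\<rho> powr (- e))\<^sup>2 = (\<rho> powr (1 / lam)) powr (2 * lam - 2 * \<delta> - 1) * \<rho> powr (1 / lam)"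
    proof -
      have "\<rho>\<^sup>2 = \<rho> powr 2" using True by simp
      moreover have "(\<rho> powr (- e))\<^sup>2 = \<rho> powr (- e + - e)"
        unfolding power2_eq_square by (rule powr_add[symmetric])
      ultimately have "\<rho>\<^sup>2 * (\<rho> powr (- e))\<^sup>2 = \<rho> powr (2 + (- e + - e))"
        by (simp only: powr_add)
      also have "2 + (- e + - e) = 1 / lam * (2 * lam - 2 * \<delta> - 1) + 1 / lam"
        using lam by (simp add: e_def field_simps)
      finally show ?thesis by (simp add: powr_add powr_powr)
    qed
    also have "(K / real M)\<^sup>2 * (Q\<^sup>2 * ((\<rho> powr (1 / lam)) powr (2 * lam - 2 * \<delta> - 1) * \<rho> powr (1 / lam)))
        \<le> (K / real M)\<^sup>2 * (Q\<^sup>2 * (X powr (2 * lam - 2 * \<delta> - 1) * \<rho> powr (1 / lam)))"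
      using True \<delta> by (intro mult_left_mono mult_right_mono powr_mono2) auto
    also have "\<dots> = R" unfolding R_def by simp
    finally show ?thesis .
  next
    case False
    show ?thesis
    proof (cases "\<rho> = 0")
      case False
      with \<open>\<not> (\<rho> > 0 \<and> \<rho> powr (1 / lam) \<le> X)\<close> \<rho>0 have gt: "\<not> \<rho> powr (1 / lam) \<le> X" by auto
      \<comment> \<open>Above the threshold X no sign change of k can lie in any of the dual
        lattices, so the mean vanishes.\<close>
      have "dual_probability \<alpha> \<gamma> \<tau> s M (?h \<sigma>) \<le> 0" if \<sigma>: "\<sigma> \<in> sign_vecs s" for \<sigma>
        using decay_le_if_dual_probability_nonzero[of M \<tau> lam \<alpha> s \<gamma> "?h \<sigma>" j, OF M \<tau> lam \<gamma>0 h(3)[OF \<sigma>] j(1) h(2)[OF \<sigma>]]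
          gt h(4)[OF \<sigma>] unfolding X_def by fastforce
      hence "E \<le> Q * 0" unfolding E_def Q_def by (rule mean_basis_average_le)
      hence "E = 0" using E0 by simp
      thus ?thesis using R0 by simp
    qed (use R0 in simp)
  qed
  thus ?thesis unfolding R_def Q2 .
qed

lemma mean_tent_lattice_error_le:
  fixes lam \<delta> \<tau> c :: real
  assumes M: "M \<ge> 2" and ne: "admissible_primes M \<noteq> {}" and s: "s \<ge> 1"
    and \<tau>: "0 < \<tau>" "\<tau> < 1" and lam: "1 / 2 < lam" "lam < \<alpha>" and \<delta>: "0 < \<delta>" "\<delta> < lam - 1 / 2"
    and \<gamma>: "\<And>j. j \<in> {1..s} \<Longrightarrow> 0 \<le> \<gamma> j \<and> \<gamma> j \<le> 1"
    and c: "c > 0" "real M \<le> c * real (card (admissible_primes M)) * ln (real M)"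
    and f: "f \<in> cosine_space \<alpha> \<gamma> s" "cosine_norm \<alpha> \<gamma> s f \<le> 1"
  defines "W \<equiv> weight_zeta_sum \<alpha> \<gamma> s lam"
    and "K \<equiv> 2 / \<tau> + 4 * c * lam / \<delta>"
  shows "1 / real (card (admissible_primes M)) * (\<Sum>N\<in>admissible_primes M.
      1 / real (card (cbc_vectors \<alpha> \<gamma> \<tau> s N)) * (\<Sum>z\<in>cbc_vectors \<alpha> \<gamma> \<tau> s N.
        \<bar>multiset_average f (tent_lattice_points s N z) - cube_integral s f\<bar>))
    \<le> K * (4 / (1 - \<tau>)) powr (lam - \<delta> - 1 / 2) / real M powr (lam + 1 / 2 - \<delta>) * W powr (lam - \<delta>)"
    (is "?lhs \<le> ?rhs")
proof -
  define P where "P = admissible_primes M"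
  define Z where "Z N = cbc_vectors \<alpha> \<gamma> \<tau> s N" for N
  define T where "T = nat_vecs s - {\<lambda>j\<in>{1..s}. 0}"
  define E where "E k = 1 / real (card P) * (\<Sum>N\<in>P. 1 / real (card (Z N)) * (\<Sum>z\<in>Z N. basis_average s N z k))" for k
  define I where "I N z = (\<Sum>\<^sub>\<infinity>k\<in>T. \<bar>cosine_coeff s f k\<bar> * basis_average s N z k)" for N z
  define X where "X = 4 * W / ((1 - \<tau>) * real M)"
  define B where "B = (K / real M)\<^sup>2 * X powr (2 * lam - 2 * \<delta> - 1) * W"
  have a: "\<alpha> / lam > 1" using lam by simp
  have W0: "W \<ge> 0" unfolding W_def by (rule weight_zeta_sum_nonneg[OF a])
  have K0: "K \<ge> 0" unfolding K_def using \<tau> c lam \<delta> by simp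
  have N0: "N > 0" if "N \<in> P" for N using admissible_primesD(2)[of N M] that by (simp add: P_def)

  have I: "((\<lambda>k. \<bar>cosine_coeff s f k\<bar> * basis_average s N z k) has_sum I N z) T" if "N \<in> P" for N z
    using tent_lattice_error_le(1)[OF N0[OF that] f(1)] unfolding I_def T_def by simp
  have "((\<lambda>k. 1 / real (card P) * (\<Sum>N\<in>P. 1 / real (card (Z N)) * (\<Sum>z\<in>Z N. \<bar>cosine_coeff s f k\<bar> * basis_average s N z k)))
      has_sum 1 / real (card P) * (\<Sum>N\<in>P. 1 / real (card (Z N)) * (\<Sum>z\<in>Z N. I N z))) T"
    using I by (intro has_sum_cmult_right has_sum_finite_sum) (auto simp: P_def Z_def)
  also have "(\<lambda>k. 1 / real (card P) * (\<Sum>N\<in>P. 1 / real (card (Z N)) * (\<Sum>z\<in>Z N. \<bar>cosine_coeff s f k\<bar> * basis_average s N z k)))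
      = (\<lambda>k. \<bar>cosine_coeff s f k\<bar> * E k)"
    unfolding E_def sum_distrib_left by (simp only: mult_ac)
  finally have hs: "((\<lambda>k. \<bar>cosine_coeff s f k\<bar> * E k) has_sum
      1 / real (card P) * (\<Sum>N\<in>P. 1 / real (card (Z N)) * (\<Sum>z\<in>Z N. I N z))) T" .

  \<comment> \<open>Cauchy-Schwarz is applied to finite index sets only; a uniform bound on the
    partial sums passes to the limit.\<close>
  have fin: "(\<Sum>k\<in>F. \<bar>cosine_coeff s f k\<bar> * E k) \<le> sqrt B" if F: "finite F" "F \<subseteq> T" for F
  proof -
    let ?r = "\<lambda>k. korobov_weight \<alpha> \<gamma> s (\<lambda>j. int (k j))"
    let ?\<rho> = "\<lambda>k. decay \<alpha> \<gamma> s (\<lambda>j. int (k j))"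
    have sub: "F \<subseteq> nat_vecs s" using F by (auto simp: T_def)
    have "(\<Sum>k\<in>F. \<bar>cosine_coeff s f k\<bar> * E k) = (\<Sum>k\<in>F. \<bar>?r k * cosine_coeff s f k\<bar> * \<bar>?\<rho> k * E k\<bar>)"
    proof (intro sum.cong refl)
      fix k assume k: "k \<in> F"
      have "E k \<ge> 0" unfolding E_def using N0
        by (intro mult_nonneg_nonneg sum_nonneg basis_average_nonneg) auto
      thus "\<bar>cosine_coeff s f k\<bar> * E k = \<bar>?r k * cosine_coeff s f k\<bar> * \<bar>?\<rho> k * E k\<bar>"
        using cosine_coeff_eq_decay[OF f(1), of k] k sub by (auto simp: abs_mult)
    qed
    also have "\<dots> \<le> L2_set (\<lambda>k. ?r k * cosine_coeff s f k) F * L2_set (\<lambda>k. ?\<rho> k * E k) F"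
      by (rule L2_set_mult_ineq)
    also have "\<dots> \<le> 1 * sqrt B"
    proof (intro mult_mono)
      have "(\<Sum>k\<in>F. (?r k * cosine_coeff s f k)\<^sup>2) = (\<Sum>k\<in>F. cosine_norm_terms \<alpha> \<gamma> s f k)"
        by (simp add: cosine_norm_terms_def power_mult_distrib)
      also have "\<dots> \<le> (\<Sum>\<^sub>\<infinity>k\<in>nat_vecs s. cosine_norm_terms \<alpha> \<gamma> s f k)"
      proof (rule finite_sum_le_infsum)
        show "cosine_norm_terms \<alpha> \<gamma> s f summable_on nat_vecs s" using f(1) by (simp add: cosine_space_def)
      qed (use F sub in \<open>auto simp: cosine_norm_terms_def\<close>)
      finally show "L2_set (\<lambda>k. ?r k * cosine_coeff s f k) F \<le> 1"
        using f(2) unfolding L2_set_def cosine_norm_def by (meson order_trans real_sqrt_le_mono)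
      have hW: "((\<lambda>k. (\<Prod>j=1..s. 2 - of_bool (k j = 0)) * ?\<rho> k powr (1 / lam)) has_sum W) T"
        unfolding T_def W_def using \<gamma> by (intro nat_vecs_decay_powr_has_sum a) auto
      have "(\<Sum>k\<in>F. (?\<rho> k * E k)\<^sup>2)
          \<le> (\<Sum>k\<in>F. (K / real M)\<^sup>2 * X powr (2 * lam - 2 * \<delta> - 1) * ((\<Prod>j=1..s. 2 - of_bool (k j = 0)) * ?\<rho> k powr (1 / lam)))"
      proof (intro sum_mono)
        fix k assume "k \<in> F"
        hence "k \<in> nat_vecs s - {\<lambda>j\<in>{1..s}. 0}" using F by (auto simp: T_def)
        from mean_basis_average_decay_le[OF M ne s \<tau> lam \<delta> \<gamma> c this]
        show "(?\<rho> k * E k)\<^sup>2 \<le> (K / real M)\<^sup>2 * X powr (2 * lam - 2 * \<delta> - 1) * ((\<Prod>j=1..s. 2 - of_bool (k j = 0)) * ?\<rho> k powr (1 / lam))"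
          unfolding E_def P_def Z_def K_def X_def W_def by simp
      qed
      also have "\<dots> = (K / real M)\<^sup>2 * X powr (2 * lam - 2 * \<delta> - 1) * (\<Sum>k\<in>F. (\<Prod>j=1..s. 2 - of_bool (k j = 0)) * ?\<rho> k powr (1 / lam))"
        by (rule sum_distrib_left[symmetric])
      also have "\<dots> \<le> B" unfolding B_def
      proof (intro mult_left_mono finite_sum_le_has_sum[OF hW])
        fix k :: "nat \<Rightarrow> nat"
        show "0 \<le> (\<Prod>j=1..s. 2 - of_bool (k j = 0)) * ?\<rho> k powr (1 / lam)"
          by (intro mult_nonneg_nonneg prod_nonneg) (auto simp: of_bool_def)
      qed (use F in auto)
      finally show "L2_set (\<lambda>k. ?\<rho> k * E k) F \<le> sqrt B"
        unfolding L2_set_def by (rule real_sqrt_le_mono)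
    qed (auto simp: L2_set_nonneg)
    finally show ?thesis by simp
  qed

  have "?lhs \<le> 1 / real (card P) * (\<Sum>N\<in>P. 1 / real (card (Z N)) * (\<Sum>z\<in>Z N. I N z))"
    unfolding P_def Z_def I_def T_def
    using tent_lattice_error_le(2)[OF admissible_primesD(2) f(1)]
    by (intro mult_left_mono sum_mono) auto
  also have "\<dots> \<le> sqrt B"
    using hs fin by (rule has_sum_le_finite_sums)
  also have "\<dots> = ?rhs"
  proof -
    have sq: "sqrt (x powr (2 * y)) = x powr y" if "x \<ge> 0" for x y :: real
      using that by (simp add: powr_half_sqrt[symmetric] powr_powr)
    have X0: "X \<ge> 0" unfolding X_def using W0 \<tau> by simp
    \<comment> \<open>With this t the powers add up: M has exponents 1 and t, W has exponents t and
      1/2.\<close>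
    define t where "t = lam - \<delta> - 1 / 2"
    have t: "t > 0" unfolding t_def using \<delta> by simp
    have "sqrt B = K / real M * X powr t * sqrt W"
      using sq[OF X0, of t] K0 unfolding B_def t_def by (simp add: real_sqrt_mult algebra_simps)
    also have "sqrt W = W powr (1 / 2)" using W0 by (simp add: powr_half_sqrt)
    also have "X = (4 / (1 - \<tau>)) * W / real M" unfolding X_def by simp
    also have "\<dots> powr t = (4 / (1 - \<tau>)) powr t * W powr t / real M powr t"
      by (simp add: powr_divide powr_mult)
    also have "K / real M * ((4 / (1 - \<tau>)) powr t * W powr t / real M powr t) * W powr (1 / 2)
        = K * (4 / (1 - \<tau>)) powr t / (real M powr 1 * real M powr t) * (W powr t * W powr (1 / 2))"
      by simp
    also have "\<dots> = ?rhs"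
      unfolding powr_add[symmetric] by (simp add: t_def algebra_simps)
    finally show ?thesis .
  qed
  finally show ?thesis .
qed

theorem theorem4p3:
  fixes lam \<delta> \<tau> :: real
  assumes "0 < \<tau>" and "\<tau> < 1"
    and "1 / 2 < lam"
    and "0 < \<delta>" and "\<delta> < min (lam - 1 / 2) 1"
  shows "\<exists>C>0. \<forall>(M::nat) (s::nat) (\<alpha>::real) (\<gamma>::nat \<Rightarrow> real).
    2 \<le> M \<longrightarrow> 1 \<le> s \<longrightarrow> 1 / 2 < \<alpha> \<longrightarrow> lam < \<alpha> \<longrightarrow> (\<forall>j\<ge>1. 0 \<le> \<gamma> j \<and> \<gamma> j \<le> 1) \<longrightarrow>
    (INF \<nu>\<in>{1 / 2..<\<alpha>}. 2 / (1 - \<tau>) * weight_zeta_sum \<alpha> \<gamma> s \<nu>) \<le> real M \<longrightarrow>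
    randomized_error \<alpha> \<gamma> \<tau> s M
      \<le> ereal (C / real M powr (lam + 1 / 2 - \<delta>) * weight_zeta_sum \<alpha> \<gamma> s lam powr (lam - \<delta>))"
proof -
  \<comment> \<open>The constant c is absolute, so the resulting C depends only on
    \<open>lam\<close>, \<delta> and \<tau>.\<close>
  obtain c where c: "c > 0"
    "\<And>M. M \<ge> 2 \<Longrightarrow> admissible_primes M \<noteq> {} \<Longrightarrow> real M \<le> c * real (card (admissible_primes M)) * ln (real M)"
    using card_admissible_primes_ge by blast
  define C where "C = (2 / \<tau> + 4 * c * lam / \<delta>) * (4 / (1 - \<tau>)) powr (lam - \<delta> - 1 / 2)"
  have "2 / \<tau> + 4 * c * lam / \<delta> > 0" using assms c(1) by (intro add_pos_pos divide_pos_pos mult_pos_pos) auto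
  hence C: "C > 0" unfolding C_def using assms by simp
  show ?thesis
  proof (intro exI[of _ C] conjI allI impI C)
    fix M s :: nat and \<alpha> :: real and \<gamma> :: "nat \<Rightarrow> real"
    assume M: "2 \<le> M" and s: "1 \<le> s" and \<alpha>: "lam < \<alpha>" and \<gamma>: "\<forall>j\<ge>1. 0 \<le> \<gamma> j \<and> \<gamma> j \<le> 1"
    show "randomized_error \<alpha> \<gamma> \<tau> s M
      \<le> ereal (C / real M powr (lam + 1 / 2 - \<delta>) * weight_zeta_sum \<alpha> \<gamma> s lam powr (lam - \<delta>))"
      unfolding randomized_error_def
    proof (rule SUP_least)
      fix f assume f: "f \<in> {f \<in> cosine_space \<alpha> \<gamma> s. cosine_norm \<alpha> \<gamma> s f \<le> 1}"
      show "ereal (1 / real (card (admissible_primes M)) * (\<Sum>N\<in>admissible_primes M.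
          1 / real (card (cbc_vectors \<alpha> \<gamma> \<tau> s N)) * (\<Sum>z\<in>cbc_vectors \<alpha> \<gamma> \<tau> s N.
            \<bar>multiset_average f (tent_lattice_points s N z) - cube_integral s f\<bar>)))
        \<le> ereal (C / real M powr (lam + 1 / 2 - \<delta>) * weight_zeta_sum \<alpha> \<gamma> s lam powr (lam - \<delta>))"
      proof (cases "admissible_primes M = {}")
        \<comment> \<open>Over an empty set of primes the mean is 0 by the conventions for division
          by zero and empty sums.\<close>
        case True
        thus ?thesis using C by simp
      next
        case False
        show ?thesis unfolding ereal_less_eq C_def
          using assms \<alpha> \<gamma> f by (intro mean_tent_lattice_error_le M False s c) auto
      qed
    qed
  qed
qed

end
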